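(* There exist absolute constants $C,C_1>0$ such that the following holds. Let $T_*\in\mathcal T(s)$ with $1\le s\le K$, and assume $$N\ge C\max\{M_1,M_2\},$$ where $$M_1=\frac{\log K}{\kappa^4(A_{\underline J},s)\,T_{\min}^3}(1\vee\xi^3),\qquad M_2=\frac{\log K}{\kappa^2(A_{\overline J},K)\,T_{\min}^2}(1\vee\xi)\left(1+\xi\sqrt{K-s}\right)$$ (in particular $\kappa(A_{\underline J},s)>0$ and $\kappa(A_{\overline J},K)>0$). Then, with probability at least $1-2p^{-1}-4K^{-1}-2e^{-K}$, $$\|\widehat T_{\rm mle}-T_*\|_1\le C_1\,\kappa^{-1}(A_{\overline J},s)\sqrt{\frac KN}.$$
   Context: Setting. $p>K\ge1$ and $N\ge 1$ are integers, $\Delta_d=\{x\in\mathbb R^d: x_j\ge 0\ \forall j,\ \sum_j x_j=1\}$, $a\vee b=\max\{a,b\}$. $A\in\mathbb R^{p\times K}$ is a known matrix whose columns belong to $\Delta_p$; $A_{j\cdot}\in\mathbb R^K$ denotes its $j$-th row (as a column vector), $A_{jS}$ its subvector with indices in $S$ and, for $U\subseteq[p]$, $A_U$ denotes the submatrix of rows in $U$. $T_*\in\Delta_K$, $\Pi_*=AT_*\in\Delta_p$, and the data $X\in\mathbb R^p$ satisfies $NX\sim\mathrm{Multinomial}_p(N;\Pi_* )$. $S_*=\mathrm{supp}(T_* )$, $T_{\min}=\min_{k\in S_*}T_{*k}$, and $\mathcal T(s)=\{T\in\Delta_K:|\mathrm{supp}(T)|=s\}$. Estimator. $J=\{j\in[p]:X_j>0\}$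 and $\widehat T_{\rm mle}\in\arg\max_{T\in\Delta_K}\sum_{j\in J}X_j\log(A_{j\cdot}^\top T)$. Quantities. $\overline J=\{j:\Pi_{*j}>0\}$; $\varepsilon_j=2\sqrt{\Pi_{*j}\log p/N}+\frac{4\log p}{3N}$; $\underline J=\{j:\Pi_{*j}>2\varepsilon_j\}$; $\xi=\max_{j\in\overline J}\|A_{jS_*^c}\|_\infty/\|A_{jS_*}\|_1$ (with $\xi=0$ if $S_*=[K]$). For a matrix $M$ with $K$ columns, $$\kappa(M,s)=\min_{S\subseteq[K],\,|S|\le s}\ \min_{v\in\mathcal C(S)}\frac{\|Mv\|_1}{\|v\|_1},\qquad \mathcal C(S)=\{v\in\mathbb R^K\setminus\{0\}:\|v_S\|_1\ge\|v_{S^c}\|_1\}.$$ *)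

theory Defs
  imports "HOL-Probability.Probability"
begin

text \<open>
  The dimensions \<open>p\<close> and \<open>K\<close> are quantified inside the constants of the theorem, so vectors of
  length \<open>d\<close> are functions on \<^typ>\<open>nat\<close>, of which only the values on \<open>{..<d}\<close> matter, and a
  \<open>p\<close> by \<open>K\<close> matrix \<open>A\<close> is a function with entries \<open>A j k\<close> for \<open>j < p\<close>, \<open>k < K\<close>.
  The submatrix of the rows in \<open>U\<close> is represented by the pair of \<open>U\<close> and \<open>A\<close>.
\<close>

definition prob_simplex :: "nat \<Rightarrow> (nat \<Rightarrow> real) set" where
  "prob_simplex d = {x. (\<forall>j<d. 0 \<le> x j) \<and> (\<Sum>j<d. x j) = 1}"

definition norm1 :: "nat set \<Rightarrow> (nat \<Rightarrow> real) \<Rightarrow> real" where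
  "norm1 I v = (\<Sum>i\<in>I. \<bar>v i\<bar>)"

definition norm_inf :: "nat set \<Rightarrow> (nat \<Rightarrow> real) \<Rightarrow> real" where
  "norm_inf I v = Max ((\<lambda>i. \<bar>v i\<bar>) ` I)"

definition mat_vec :: "nat \<Rightarrow> (nat \<Rightarrow> nat \<Rightarrow> real) \<Rightarrow> (nat \<Rightarrow> real) \<Rightarrow> nat \<Rightarrow> real" where
  "mat_vec K A v = (\<lambda>j. \<Sum>k<K. A j k * v k)"

definition supp :: "nat \<Rightarrow> (nat \<Rightarrow> real) \<Rightarrow> nat set" where
  "supp d x = {k. k < d \<and> x k \<noteq> 0}"

definition sparse_simplex :: "nat \<Rightarrow> nat \<Rightarrow> (nat \<Rightarrow> real) set" where
  "sparse_simplex K s = {T \<in> prob_simplex K. card (supp K T) = s}"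

definition T_min :: "nat \<Rightarrow> (nat \<Rightarrow> real) \<Rightarrow> real" where
  "T_min K T = Min (T ` supp K T)"


definition categorical_pmf :: "nat \<Rightarrow> (nat \<Rightarrow> real) \<Rightarrow> nat pmf" where
  "categorical_pmf p P = embed_pmf (\<lambda>j. if j < p then P j else 0)"

lemma pmf_categorical_pmf:
  assumes "P \<in> prob_simplex p"
  shows "pmf (categorical_pmf p P) j = (if j < p then P j else 0)"
  unfolding categorical_pmf_def
proof (rule pmf_embed_pmf)
  show "0 \<le> (if x < p then P x else 0)" for x
    using assms by (auto simp: prob_simplex_def)
  have "(\<integral>\<^sup>+x. ennreal (if x < p then P x else 0) \<partial>count_space UNIV)
      = (\<Sum>x<p. ennreal (if x < p then P x else 0))"
    by (rule nn_integral_count_space') auto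
  also have "\<dots> = (\<Sum>x<p. ennreal (P x))"
    by (rule sum.cong) auto
  also have "\<dots> = ennreal (\<Sum>x<p. P x)"
    using assms by (intro sum_ennreal) (auto simp: prob_simplex_def)
  finally show "(\<integral>\<^sup>+x. ennreal (if x < p then P x else 0) \<partial>count_space UNIV) = 1"
    using assms by (simp add: prob_simplex_def)
qed

lemma mat_vec_prob_simplex:
  assumes "\<forall>k<K. (\<lambda>j. A j k) \<in> prob_simplex p" "T \<in> prob_simplex K"
  shows "mat_vec K A T \<in> prob_simplex p"
proof -
  have "(\<Sum>j<p. \<Sum>k<K. A j k * T k) = (\<Sum>k<K. (\<Sum>j<p. A j k) * T k)"
    by (subst sum.swap) (simp add: sum_distrib_right)
  also have "\<dots> = (\<Sum>k<K. T k)"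
    using assms(1) by (intro sum.cong) (auto simp: prob_simplex_def)
  finally show ?thesis
    using assms by (auto simp: prob_simplex_def mat_vec_def intro!: sum_nonneg mult_nonneg_nonneg)
qed

text \<open>The law of the vector of category counts of \<open>N\<close> independent draws.\<close>

definition multinomial_pmf :: "nat \<Rightarrow> nat \<Rightarrow> (nat \<Rightarrow> real) \<Rightarrow> (nat \<Rightarrow> nat) pmf" where
  "multinomial_pmf p N P = map_pmf count_list (replicate_pmf N (categorical_pmf p P))"

text \<open>The law of \<open>X\<close> when \<open>N X\<close> is multinomial with parameters \<open>N\<close> and \<open>P\<close>.\<close>

definition frequency_pmf :: "nat \<Rightarrow> nat \<Rightarrow> (nat \<Rightarrow> real) \<Rightarrow> (nat \<Rightarrow> real) pmf" where
  "frequency_pmf p N P = map_pmf (\<lambda>Y j. real (Y j) / real N) (multinomial_pmf p N P)"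


text \<open>
  Since \<^term>\<open>ln (0::real) = 0\<close> in the library, the likelihood needs the extended logarithm, which
  is minus infinity at 0. All weights \<open>X j\<close> below are positive and no logarithm is plus infinity,
  so the sum in \<^typ>\<open>ereal\<close> is unambiguous.
\<close>

definition elog :: "real \<Rightarrow> ereal" where
  "elog x = (if 0 < x then ereal (ln x) else - \<infinity>)"

definition log_lik :: "nat \<Rightarrow> nat \<Rightarrow> (nat \<Rightarrow> nat \<Rightarrow> real) \<Rightarrow> (nat \<Rightarrow> real) \<Rightarrow> (nat \<Rightarrow> real) \<Rightarrow> ereal" where
  "log_lik p K A X T = (\<Sum>j\<in>{j. j < p \<and> 0 < X j}. ereal (X j) * elog (mat_vec K A T j))"

definition is_mle :: "nat \<Rightarrow> nat \<Rightarrow> (nat \<Rightarrow> nat \<Rightarrow> real) \<Rightarrow> (nat \<Rightarrow> real) \<Rightarrow> (nat \<Rightarrow> real) \<Rightarrow> bool" where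
  "is_mle p K A X T \<longleftrightarrow> is_arg_max (log_lik p K A X) (\<lambda>T. T \<in> prob_simplex K) T"


definition J_over :: "nat \<Rightarrow> (nat \<Rightarrow> real) \<Rightarrow> nat set" where
  "J_over p P = {j. j < p \<and> 0 < P j}"

definition eps :: "nat \<Rightarrow> nat \<Rightarrow> (nat \<Rightarrow> real) \<Rightarrow> nat \<Rightarrow> real" where
  "eps p N P j = 2 * sqrt (P j * ln (real p) / real N) + 4 * ln (real p) / (3 * real N)"

definition J_under :: "nat \<Rightarrow> nat \<Rightarrow> (nat \<Rightarrow> real) \<Rightarrow> nat set" where
  "J_under p N P = {j. j < p \<and> P j > 2 * eps p N P j}"

definition xi :: "nat \<Rightarrow> nat \<Rightarrow> (nat \<Rightarrow> nat \<Rightarrow> real) \<Rightarrow> (nat \<Rightarrow> real) \<Rightarrow> real" where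
  "xi p K A T =
    (if supp K T = {..<K} then 0
     else Max ((\<lambda>j. norm_inf ({..<K} - supp K T) (A j) / norm1 (supp K T) (A j))
                ` J_over p (mat_vec K A T)))"

definition cone :: "nat \<Rightarrow> nat set \<Rightarrow> (nat \<Rightarrow> real) set" where
  "cone K S = {v. (\<exists>k<K. v k \<noteq> 0) \<and> norm1 ({..<K} - S) v \<le> norm1 S v}"

text \<open>
  The iterated minimum is one infimum over all pairs \<open>(S, v)\<close>, because \<^term>\<open>cone K {}\<close> is empty
  and \<open>S = {}\<close> must not contribute. For \<open>s, K \<ge> 1\<close> the infimum is attained: the ratio is invariant
  under scaling, and each cone meets the unit sphere in a compact set.
\<close>

definition kappa :: "nat \<Rightarrow> nat set \<Rightarrow> (nat \<Rightarrow> nat \<Rightarrow> real) \<Rightarrow> nat \<Rightarrow> real" where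
  "kappa K U A s =
    (INF (S, v) \<in> (SIGMA S:{S. S \<subseteq> {..<K} \<and> card S \<le> s}. cone K S).
       norm1 U (mat_vec K A v) / norm1 {..<K} v)"

definition M1 :: "nat \<Rightarrow> nat \<Rightarrow> nat \<Rightarrow> (nat \<Rightarrow> nat \<Rightarrow> real) \<Rightarrow> (nat \<Rightarrow> real) \<Rightarrow> nat \<Rightarrow> real" where
  "M1 p K N A T s =
     ln (real K) / (kappa K (J_under p N (mat_vec K A T)) A s ^ 4 * T_min K T ^ 3)
       * max 1 (xi p K A T ^ 3)"

definition M2 :: "nat \<Rightarrow> nat \<Rightarrow> (nat \<Rightarrow> nat \<Rightarrow> real) \<Rightarrow> (nat \<Rightarrow> real) \<Rightarrow> nat \<Rightarrow> real" where
  "M2 p K A T s =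
     ln (real K) / (kappa K (J_over p (mat_vec K A T)) A K ^ 2 * T_min K T ^ 2)
       * max 1 (xi p K A T) * (1 + xi p K A T * sqrt (real K - real s))"

end

theory Submission
  imports Defs
begin

text \<open>
  Write \<open>\<pi> = A T\<close>, let \<open>v\<close> be the error of the estimator, and let \<open>r\<^sub>j = (A v)\<^sub>j / \<pi>\<^sub>j\<close> be the relative
  error of the fitted probability of word \<open>j\<close>. Maximality of the likelihood says
  \<open>0 \<le> \<Sum>\<^sub>j X\<^sub>j ln (1 + r\<^sub>j)\<close>. By concavity this survives shrinking \<open>v\<close>, and as soon as \<open>\<bar>r\<^sub>j\<bar> \<le> 1/4\<close> it gives
  \<open>0 \<le> \<Sum>\<^sub>j X\<^sub>j (r\<^sub>j - r\<^sub>j\<^sup>2/3)\<close>. Moreover \<open>\<Sum>\<^sub>j \<pi>\<^sub>j r\<^sub>j \<le> 0\<close> over the words of positive probability, since the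
  fitted probabilities have sum 1. So a quadratic term is bounded by the noise
  \<open>\<Sum>\<^sub>j (X\<^sub>j - \<pi>\<^sub>j) r\<^sub>j\<close>.

  This is exploited at two scales. First (\<open>crude_rate\<close>), the noise is at most
  \<open>\<parallel>v\<parallel>\<^sub>1\<close> times a maximum over the \<open>K\<close> columns, of order \<open>sqrt (m ln K / N)\<close> with
  \<open>m = max 1 \<xi> / T\<^sub>m\<^sub>i\<^sub>n\<close>, while the quadratic term is bounded below through the frequent words,
  whose observed frequencies are at least half of the true ones. The condition on \<open>M\<^sub>1\<close> makes this
  strong enough to show \<open>\<parallel>v\<parallel>\<^sub>1 \<le> 1 / (4 m)\<close>, hence \<open>\<bar>r\<^sub>j\<bar> \<le> 1/4\<close> for every word of positive probability.

  Second (\<open>fine_rate\<close>), the norm \<open>(\<Sum>\<^sub>j \<pi>\<^sub>j r\<^sub>j\<^sup>2)\<^bsup>1/2\<^esup>\<close> is shown to be at most \<open>\<rho> = 100 sqrt (K / N)\<close>; the bound on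
  \<open>\<parallel>v\<parallel>\<^sub>1\<close> follows by the Cauchy-Schwarz inequality and the definition of \<open>\<kappa>\<close>, as \<open>v\<close> lies in the cone of
  the support of \<open>T\<close>. The relative errors range over a space of dimension at most \<open>K\<close>; take an
  orthonormal system \<open>f\<^sub>1, \<dots>, f\<^sub>K\<close> of it with respect to \<open>\<pi>\<close>. At a single fixed \<open>r\<close> of norm about \<open>\<rho>\<close>
  that carries little of it in large values, the statistic \<open>\<Sum>\<^sub>j X\<^sub>j (r\<^sub>j - r\<^sub>j\<^sup>2/3) - \<Sum>\<^sub>j \<pi>\<^sub>j r\<^sub>j\<close> is clearly negative except with probability
  \<open>exp (- c N \<rho>\<^sup>2)\<close>, so a union bound covers the \<open>exp (O(K))\<close> relevant points of a lattice of mesh of order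
  \<open>\<rho> / sqrt K\<close> in the coordinates of the system (\<open>prob_lattice_excess_le\<close>). To pass from
  the lattice to all \<open>r\<close>, round the coordinates of \<open>r\<close> one at a time in the favourable direction
  (\<open>round_to_lattice\<close>): the loss is then at most a multiple of
  \<open>(\<rho>\<^sup>2 / K) \<Sum>\<^sub>j X\<^sub>j \<Sum>\<^sub>l f\<^sub>l(j)\<^sup>2\<close>, whose random factor is a scalar average with mean at most \<open>K\<close>
  and with terms bounded by virtue of the condition on \<open>M\<^sub>2\<close>.
\<close>

section \<open>Elementary inequalities\<close>

text \<open>
  On a neighbourhood of 0 the log-likelihood ratio is dominated by a concave quadratic. Any
  coefficient of the square below 1/2 would do after shrinking the neighbourhood; 1/3 suits 1/4.
\<close>

lemma ln_one_plus_le_quadratic: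
  fixes r :: real
  assumes "\<bar>r\<bar> \<le> 1 / 4"
  shows "ln (1 + r) \<le> r - r\<^sup>2 / 3"
proof -
  define \<phi> where "\<phi> = (\<lambda>x::real. x - x\<^sup>2 / 3 - ln (1 + x))"
  have deriv: "(\<phi> has_real_derivative x * (1 - 2 * x) / (3 * (1 + x))) (at x)" if "\<bar>x\<bar> \<le> 1 / 4" for x
    unfolding \<phi>_def using that
    by (auto intro!: derivative_eq_intros simp: field_simps power2_eq_square)
  have "\<phi> 0 \<le> \<phi> r"
  proof (cases "0 \<le> r")
    case True
    show ?thesis
    proof (rule DERIV_nonneg_imp_nondecreasing[OF True])
      fix x assume x: "0 \<le> x" "x \<le> r"
      then have "0 \<le> x * (1 - 2 * x) / (3 * (1 + x))"
        using assms by (intro divide_nonneg_nonneg mult_nonneg_nonneg) auto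
      then show "\<exists>y. (\<phi> has_real_derivative y) (at x) \<and> 0 \<le> y"
        using deriv[of x] x assms by auto
    qed
  next
    case False
    show ?thesis
    proof (rule DERIV_nonpos_imp_nonincreasing[of r 0 \<phi>])
      show "r \<le> 0" using False by simp
      fix x assume x: "r \<le> x" "x \<le> 0"
      then have "x * (1 - 2 * x) / (3 * (1 + x)) \<le> 0"
        using assms by (intro divide_nonpos_nonneg mult_nonpos_nonneg) auto
      then show "\<exists>y. (\<phi> has_real_derivative y) (at x) \<and> y \<le> 0"
        using deriv[of x] x assms by auto
    qed
  qed
  then show ?thesis
    by (simp add: \<phi>_def)
qed

lemma exp_le_quadratic:
  fixes y :: real
  assumes "y \<le> 1"
  shows "exp y \<le> 1 + y + y\<^sup>2"
proof (cases "0 \<le> y")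
  case True
  then show ?thesis using assms by (intro exp_bound) auto
next
  case False
  have "(1 + y + y\<^sup>2) * (1 - y) = 1 - y ^ 3"
    by (simp add: algebra_simps power2_eq_square power3_eq_cube)
  moreover have "y ^ 3 \<le> 0"
    using False by (simp add: power_le_zero_eq)
  ultimately have "1 \<le> (1 + y + y\<^sup>2) * (1 - y)"
    by linarith
  also have "\<dots> \<le> (1 + y + y\<^sup>2) * exp (- y)"
  proof (rule mult_left_mono)
    show "1 - y \<le> exp (- y)"
      using exp_ge_add_one_self[of "- y"] by simp
    have "1 + y + y\<^sup>2 = (1 / 2 + y)\<^sup>2 + 3 / 4"
      by (simp add: power2_eq_square algebra_simps)
    then show "0 \<le> 1 + y + y\<^sup>2" by simp
  qed
  finally show ?thesis
    by (simp add: exp_minus field_simps)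
qed

text \<open>
  The moment generating function of the concave quadratic, for \<^emph>\<open>every\<close> real argument. For small
  \<open>r\<close> the square in the exponent wins over the second order term of the exponential, which leaves
  a negative quadratic. For large negative \<open>r\<close> no bound with the same linear term and a negative
  quadratic can hold; the indicator pays for these arguments, and it will be charged to a rounding
  error.
\<close>

lemma exp_penalised_le:
  fixes r :: real
  shows "exp ((r - r\<^sup>2 / 3) / 10) \<le> 1 + r / 10 - r\<^sup>2 / 60 + (if \<bar>r\<bar> > 1 / 2 then r\<^sup>2 else 0)"
proof -
  \<comment> \<open>The exponent is bounded above, with maximum attained at \<open>r = 3/2\<close>.\<close>
  define y where "y = (r - r\<^sup>2 / 3) / 10"
  have "0 \<le> (2 * r - 3)\<^sup>2" by simp
  then have y_le: "y \<le> 3 / 40"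
    by (simp add: y_def power2_eq_square algebra_simps)
  show ?thesis
  proof (cases "\<bar>r\<bar> > 1 / 2")
    case False
    have "(1 - r / 3)\<^sup>2 \<le> (7 / 6)\<^sup>2"
      using False by (intro power_mono) auto
    then have "r\<^sup>2 * (1 - r / 3)\<^sup>2 \<le> r\<^sup>2 * (7 / 6)\<^sup>2"
      by (intro mult_left_mono) auto
    moreover have "y\<^sup>2 = r\<^sup>2 * (1 - r / 3)\<^sup>2 / 100"
      by (simp add: y_def power2_eq_square algebra_simps)
    ultimately have "y\<^sup>2 \<le> r\<^sup>2 * (49 / 3600)"
      by (simp add: power2_eq_square)
    moreover have "exp y \<le> 1 + y + y\<^sup>2"
      using y_le by (intro exp_le_quadratic) auto
    moreover have "y = r / 10 - r\<^sup>2 / 30"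
      by (simp add: y_def)
    moreover have "0 \<le> r\<^sup>2" by simp
    ultimately have "exp y \<le> 1 + r / 10 - r\<^sup>2 / 60"
      by linarith
    then show ?thesis
      using False by (simp add: y_def)
  next
    case True
    have "exp y \<le> exp (3 / 40)" using y_le by simp
    also have "\<dots> \<le> 1 + 3 / 40 + (3 / 40)\<^sup>2" by (intro exp_le_quadratic) auto
    also have "\<dots> \<le> 1 + 1 / 10"
      by (simp add: power2_eq_square)
    finally have 1: "exp y \<le> 1 + 1 / 10" .
    have "1 / 2 * \<bar>r\<bar> \<le> \<bar>r\<bar> * \<bar>r\<bar>"
      using True by (intro mult_right_mono) auto
    then have 2: "\<bar>r\<bar> \<le> 2 * r\<^sup>2"
      by (simp add: power2_eq_square)
    then have "1 / 4 \<le> r\<^sup>2" using True by linarith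
    then show ?thesis
      using 1 2 True unfolding y_def[symmetric] by simp
  qed
qed

lemma exp_minus_one_le: "exp (- 1 :: real) \<le> 3 / 8"
proof -
  have "(8 / 3 :: real) \<le> (\<Sum>n<5. 1 ^ n / fact n)"
    by (simp add: eval_nat_numeral)
  also have "\<dots> \<le> exp 1"
    using summable_exp[of "1::real"]
    unfolding exp_def
    by (intro order.trans[OF _ sum_le_suminf]) (auto simp: field_simps scaleR_conv_of_real)
  finally show ?thesis
    by (simp add: exp_minus field_simps)
qed

section \<open>Chernoff bound for multinomial frequencies\<close>

lemma nn_integral_exp_sum_replicate_pmf:
  fixes g :: "'a \<Rightarrow> real"
  shows "(\<integral>\<^sup>+xs. ennreal (exp (sum_list (map g xs))) \<partial>replicate_pmf n D)
       = (\<integral>\<^sup>+x. ennreal (exp (g x)) \<partial>D) ^ n"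
proof (induction n)
  case 0
  then show ?case by simp
next
  case (Suc n)
  have "(\<integral>\<^sup>+xs. ennreal (exp (sum_list (map g xs))) \<partial>replicate_pmf (Suc n) D)
      = (\<integral>\<^sup>+x. ennreal (exp (g x)) * (\<integral>\<^sup>+xs. ennreal (exp (sum_list (map g xs))) \<partial>replicate_pmf n D) \<partial>D)"
    by (simp add: map_pmf_def[symmetric] nn_integral_bind_pmf exp_add ennreal_mult nn_integral_cmult)
  then show ?case
    by (simp add: Suc nn_integral_multc)
qed

lemma finite_J_over [simp]: "finite (J_over p P)"
  by (simp add: J_over_def)

lemma set_pmf_categorical_pmf:
  assumes "P \<in> prob_simplex p"
  shows "set_pmf (categorical_pmf p P) = J_over p P"
  using assms by (auto simp: set_pmf_eq pmf_categorical_pmf J_over_def prob_simplex_def)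

lemma sum_count_list_eq_sum_list:
  fixes g :: "'a \<Rightarrow> real"
  assumes "finite J" "set xs \<subseteq> J"
  shows "(\<Sum>j\<in>J. real (count_list xs j) * g j) = sum_list (map g xs)"
  using assms(2)
proof (induction xs)
  case (Cons x xs)
  have "(\<Sum>j\<in>J. real (count_list (x # xs) j) * g j)
      = (\<Sum>j\<in>J. real (count_list xs j) * g j + (if j = x then g j else 0))"
    by (intro sum.cong) (auto simp: algebra_simps)
  then show ?case
    using Cons assms(1) by (simp add: sum.distrib)
qed simp

lemma frequency_pmf_support:
  assumes "P \<in> prob_simplex p" "X \<in> set_pmf (frequency_pmf p N P)"
  shows "0 \<le> X j" "j \<notin> J_over p P \<Longrightarrow> X j = 0"
proof -
  obtain xs where xs: "X = (\<lambda>j. real (count_list xs j) / real N)" "set xs \<subseteq> J_over p P"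
    using assms(2) unfolding frequency_pmf_def multinomial_pmf_def
    by (auto simp: set_replicate_pmf set_pmf_categorical_pmf[OF assms(1)])
  show "0 \<le> X j" by (simp add: xs)
  show "X j = 0" if "j \<notin> J_over p P"
    using that xs by (auto simp: count_list_0_iff)
qed

text \<open>
  The Chernoff bound for linear statistics of the observed frequencies. Every probability estimate
  below is an instance: \<open>N\<close> times such a statistic is a sum over \<open>N\<close> independent words, so its
  exponential moment is a power of the one-word moment.
\<close>

lemma prob_frequency_pmf_ge_le:
  assumes P: "P \<in> prob_simplex p" and N: "1 \<le> N"
    and mgf: "(\<Sum>j\<in>J_over p P. P j * exp (g j)) \<le> exp a"
  shows "measure_pmf.prob (frequency_pmf p N P) {X. t \<le> (\<Sum>j\<in>J_over p P. X j * g j)}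
       \<le> exp (real N * (a - t))"
proof -
  let ?J = "J_over p P" and ?D = "categorical_pmf p P"
  let ?R = "replicate_pmf N ?D"
  have sum_eq: "real N * (\<Sum>j\<in>?J. real (count_list xs j) / real N * g j) = sum_list (map g xs)"
    if "xs \<in> set_pmf ?R" for xs
  proof -
    have xs: "set xs \<subseteq> ?J"
      using that by (auto simp: set_replicate_pmf set_pmf_categorical_pmf[OF P])
    have "real N * (\<Sum>j\<in>?J. real (count_list xs j) / real N * g j) = (\<Sum>j\<in>?J. real (count_list xs j) * g j)"
      using N by (simp add: sum_distrib_left)
    also have "\<dots> = sum_list (map g xs)"
      using xs by (intro sum_count_list_eq_sum_list) auto
    finally show ?thesis .
  qed
  have D: "(\<integral>\<^sup>+x. ennreal (exp (g x)) \<partial>?D) = ennreal (\<Sum>j\<in>?J. P j * exp (g j))"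
  proof -
    have "(\<integral>\<^sup>+x. ennreal (exp (g x)) \<partial>?D) = (\<Sum>j\<in>?J. ennreal (exp (g j)) * ennreal (pmf ?D j))"
      by (subst nn_integral_measure_pmf_finite)
         (auto simp: set_pmf_categorical_pmf[OF P])
    also have "\<dots> = (\<Sum>j\<in>?J. ennreal (P j * exp (g j)))"
      by (intro sum.cong) (auto simp: pmf_categorical_pmf[OF P] J_over_def ennreal_mult[symmetric] mult.commute)
    also have "\<dots> = ennreal (\<Sum>j\<in>?J. P j * exp (g j))"
      by (intro sum_ennreal) (auto simp: J_over_def)
    finally show ?thesis .
  qed
  let ?E = "{xs. t \<le> (\<Sum>j\<in>?J. real (count_list xs j) / real N * g j)}"
  have "measure_pmf.prob (frequency_pmf p N P) {X. t \<le> (\<Sum>j\<in>?J. X j * g j)} = measure_pmf.prob ?R ?E"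
    by (simp add: frequency_pmf_def multinomial_pmf_def vimage_def)
  moreover have "ennreal (measure_pmf.prob ?R ?E) \<le> ennreal (exp (real N * (a - t)))"
  proof -
    have "ennreal (measure_pmf.prob ?R ?E) = (\<integral>\<^sup>+xs. indicator ?E xs \<partial>?R)"
      by (simp add: measure_pmf.emeasure_eq_measure)
    also have "\<dots> \<le> (\<integral>\<^sup>+xs. ennreal (exp (- real N * t)) * ennreal (exp (sum_list (map g xs))) \<partial>?R)"
    proof (rule nn_integral_mono_AE, rule AE_pmfI)
      fix xs assume "xs \<in> set_pmf ?R"
      note eq = sum_eq[OF this]
      show "indicator ?E xs \<le> ennreal (exp (- real N * t)) * ennreal (exp (sum_list (map g xs)))"
      proof (cases "xs \<in> ?E")
        case True
        then have "real N * t \<le> sum_list (map g xs)"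
          unfolding eq[symmetric] using N by (intro mult_left_mono) auto
        then have "1 \<le> exp (- real N * t) * exp (sum_list (map g xs))"
          by (simp add: exp_add[symmetric])
        then show ?thesis
          using True by (simp add: ennreal_mult[symmetric] del: mult_minus_left)
      qed simp
    qed
    also have "\<dots> = ennreal (exp (- real N * t)) * ennreal (\<Sum>j\<in>?J. P j * exp (g j)) ^ N"
      by (simp add: nn_integral_cmult nn_integral_exp_sum_replicate_pmf D)
    also have "\<dots> = ennreal (exp (- real N * t) * (\<Sum>j\<in>?J. P j * exp (g j)) ^ N)"
    proof -
      have "0 \<le> (\<Sum>j\<in>?J. P j * exp (g j))"
        by (intro sum_nonneg) (auto simp: J_over_def)
      then show ?thesis
        by (simp add: ennreal_mult ennreal_power)
    qed
    also have "\<dots> \<le> ennreal (exp (- real N * t) * exp a ^ N)"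
      using mgf by (intro ennreal_leI mult_left_mono power_mono sum_nonneg) (auto simp: J_over_def)
    also have "exp (- real N * t) * exp a ^ N = exp (real N * (a - t))"
      by (simp add: exp_of_nat_mult[symmetric] exp_add[symmetric] algebra_simps)
    finally show ?thesis .
  qed
  ultimately show ?thesis
    by (simp add: ennreal_le_iff)
qed

section \<open>Orthonormal systems in a weighted space\<close>

definition lincomb :: "nat \<Rightarrow> (nat \<Rightarrow> 'a \<Rightarrow> real) \<Rightarrow> (nat \<Rightarrow> real) \<Rightarrow> 'a \<Rightarrow> real" where
  "lincomb n g v j = (\<Sum>k<n. v k * g k j)"

text \<open>
  The squared norm of the weighted space \<open>L\<^sup>2(J, P)\<close>.
\<close>

definition wnorm2 :: "'a set \<Rightarrow> ('a \<Rightarrow> real) \<Rightarrow> ('a \<Rightarrow> real) \<Rightarrow> real" where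
  "wnorm2 J P r = (\<Sum>j\<in>J. P j * (r j)\<^sup>2)"

lemma wnorm2_nonneg:
  assumes "\<And>j. j \<in> J \<Longrightarrow> 0 \<le> P j"
  shows "0 \<le> wnorm2 J P r"
  using assms by (auto simp: wnorm2_def intro!: sum_nonneg)

lemma wnorm2_eq_0_imp:
  assumes "finite J" "\<And>j. j \<in> J \<Longrightarrow> 0 < P j" "wnorm2 J P r = 0" "j \<in> J"
  shows "r j = 0"
proof -
  have "\<forall>j\<in>J. P j * (r j)\<^sup>2 = 0"
    using assms(3) unfolding wnorm2_def
    by (subst (asm) sum_nonneg_eq_0_iff[OF assms(1)]) (use assms(2) in \<open>auto simp: less_imp_le\<close>)
  then show ?thesis using assms(2,4) by force
qed

lemma weighted_cauchy_schwarz: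
  fixes P x y :: "'a \<Rightarrow> real"
  assumes "\<And>j. j \<in> J \<Longrightarrow> 0 \<le> P j"
  shows "(\<Sum>j\<in>J. P j * (x j * y j))\<^sup>2 \<le> wnorm2 J P x * wnorm2 J P y"
proof -
  have "(\<Sum>j\<in>J. (sqrt (P j) * x j) * (sqrt (P j) * y j))\<^sup>2
      \<le> (\<Sum>j\<in>J. (sqrt (P j) * x j)\<^sup>2) * (\<Sum>j\<in>J. (sqrt (P j) * y j)\<^sup>2)"
    by (rule Cauchy_Schwarz_ineq_sum)
  moreover have "(\<Sum>j\<in>J. (sqrt (P j) * x j) * (sqrt (P j) * y j)) = (\<Sum>j\<in>J. P j * (x j * y j))"
    using assms by (intro sum.cong) (auto simp: algebra_simps simp flip: power2_eq_square real_sqrt_mult)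
  moreover have "(\<Sum>j\<in>J. (sqrt (P j) * x j)\<^sup>2) = wnorm2 J P x" for x
    unfolding wnorm2_def using assms by (intro sum.cong) (auto simp: power_mult_distrib)
  ultimately show ?thesis by simp
qed

text \<open>
  Zero functions are admitted as members, so that a family of \<open>n\<close> functions always yields a system of
  the same length \<open>n\<close>, whatever its rank.
\<close>

definition orthonormal_upto :: "'a set \<Rightarrow> ('a \<Rightarrow> real) \<Rightarrow> nat \<Rightarrow> (nat \<Rightarrow> 'a \<Rightarrow> real) \<Rightarrow> bool" where
  "orthonormal_upto J P n f \<longleftrightarrow>
     (\<forall>l<n. \<forall>m<n. l \<noteq> m \<longrightarrow> (\<Sum>j\<in>J. P j * (f l j * f m j)) = 0) \<and>
     (\<forall>l<n. wnorm2 J P (f l) = 1 \<or> (\<forall>j\<in>J. f l j = 0))"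

lemma lincomb_0 [simp]: "lincomb 0 g v j = 0"
  by (simp add: lincomb_def)

lemma lincomb_Suc: "lincomb (Suc n) g v j = lincomb n g v j + v n * g n j"
  by (simp add: lincomb_def)

lemma lincomb_cong: "(\<And>k. k < n \<Longrightarrow> v k = w k) \<Longrightarrow> lincomb n g v j = lincomb n g w j"
  by (simp add: lincomb_def)

lemma lincomb_scale: "lincomb n g (\<lambda>k. t * v k) j = t * lincomb n g v j"
  by (simp add: lincomb_def sum_distrib_left mult_ac)

lemma lincomb_diff: "lincomb n g (\<lambda>k. v k - w k) j = lincomb n g v j - lincomb n g w j"
  by (simp add: lincomb_def sum_subtractf algebra_simps)

lemma lincomb_add: "lincomb n g (\<lambda>k. v k + w k) j = lincomb n g v j + lincomb n g w j"
  by (simp add: lincomb_def sum.distrib algebra_simps)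

lemma lincomb_update:
  assumes "n < K"
  shows "lincomb K f (w(n := w n + \<delta>)) j = lincomb K f w j + \<delta> * f n j"
proof -
  have "w(n := w n + \<delta>) = (\<lambda>k. w k + (if k = n then \<delta> else 0))"
    by auto
  then have "lincomb K f (w(n := w n + \<delta>)) j = lincomb K f w j + lincomb K f (\<lambda>k. if k = n then \<delta> else 0) j"
    by (simp only: lincomb_add)
  moreover have "lincomb K f (\<lambda>k. if k = n then \<delta> else 0) j = (\<Sum>k<K. if k = n then \<delta> * f n j else 0)"
    unfolding lincomb_def by (intro sum.cong) auto
  ultimately show ?thesis using assms by (simp del: fun_upd_apply)
qed

lemma inner_lincomb_left:
  "(\<Sum>j\<in>J. P j * (lincomb n f v j * y j)) = (\<Sum>l<n. v l * (\<Sum>j\<in>J. P j * (f l j * y j)))"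
proof -
  have "(\<Sum>j\<in>J. P j * (lincomb n f v j * y j)) = (\<Sum>j\<in>J. \<Sum>l<n. v l * (P j * (f l j * y j)))"
    by (simp add: lincomb_def sum_distrib_left sum_distrib_right mult_ac)
  then show ?thesis
    by (subst (asm) sum.swap) (simp add: sum_distrib_left)
qed

lemma inner_lincomb_orthonormal:
  assumes "orthonormal_upto J P n f" "l < n"
  shows "(\<Sum>j\<in>J. P j * (lincomb n f v j * f l j)) = v l * wnorm2 J P (f l)"
proof -
  have "(\<Sum>j\<in>J. P j * (lincomb n f v j * f l j)) = (\<Sum>m<n. if m = l then v l * wnorm2 J P (f l) else 0)"
    unfolding inner_lincomb_left using assms
    by (intro sum.cong) (auto simp: orthonormal_upto_def wnorm2_def power2_eq_square)
  then show ?thesis using assms by simp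
qed

lemma wnorm2_lincomb_orthonormal:
  assumes "orthonormal_upto J P n f"
  shows "wnorm2 J P (lincomb n f v) = (\<Sum>l<n. (v l)\<^sup>2 * wnorm2 J P (f l))"
proof -
  have "wnorm2 J P (lincomb n f v) = (\<Sum>j\<in>J. P j * (lincomb n f v j * lincomb n f v j))"
    by (simp add: wnorm2_def power2_eq_square)
  also have "\<dots> = (\<Sum>l<n. v l * (\<Sum>j\<in>J. P j * (f l j * lincomb n f v j)))"
    by (rule inner_lincomb_left)
  also have "\<dots> = (\<Sum>l<n. v l * (v l * wnorm2 J P (f l)))"
    using inner_lincomb_orthonormal[OF assms] by (intro sum.cong) (auto simp: mult.commute)
  finally show ?thesis by (simp add: power2_eq_square mult_ac)
qed

lemma orthonormal_wnorm2_cases: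
  assumes "orthonormal_upto J P n f" "l < n"
  shows "wnorm2 J P (f l) = 1 \<or> wnorm2 J P (f l) = 0"
  using assms by (auto simp: orthonormal_upto_def wnorm2_def)

lemma wnorm2_lincomb_orthonormal_le:
  assumes "orthonormal_upto J P n f"
  shows "wnorm2 J P (lincomb n f v) \<le> (\<Sum>l<n. (v l)\<^sup>2)"
  unfolding wnorm2_lincomb_orthonormal[OF assms]
  using orthonormal_wnorm2_cases[OF assms] by (intro sum_mono) force

lemma lincomb_compose:
  fixes g :: "nat \<Rightarrow> 'a \<Rightarrow> real"
  assumes "\<And>l. l < n \<Longrightarrow> \<exists>c. \<forall>j\<in>J. f l j = lincomb m g c j"
  obtains c where "\<And>j. j \<in> J \<Longrightarrow> lincomb n f d j = lincomb m g c j"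
proof -
  from assms obtain c where c: "\<And>l j. l < n \<Longrightarrow> j \<in> J \<Longrightarrow> f l j = lincomb m g (c l) j"
    by metis
  have "lincomb n f d j = lincomb m g (\<lambda>k. \<Sum>l<n. d l * c l k) j" if "j \<in> J" for j
  proof -
    have "lincomb n f d j = (\<Sum>l<n. \<Sum>k<m. d l * c l k * g k j)"
      using c that by (simp add: lincomb_def sum_distrib_left mult_ac)
    also have "\<dots> = (\<Sum>k<m. \<Sum>l<n. d l * c l k * g k j)"
      by (rule sum.swap)
    finally show ?thesis by (simp add: lincomb_def sum_distrib_right)
  qed
  then show ?thesis by (rule that)
qed

text \<open>
  A function whose component orthogonal to its predecessors vanishes is replaced by 0: division by
  \<open>s = 0\<close> does this.
\<close>

lemma gram_schmidt:
  fixes g :: "nat \<Rightarrow> 'a \<Rightarrow> real"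
  assumes J: "finite J" and P: "\<And>j. j \<in> J \<Longrightarrow> 0 < P j"
  shows "\<exists>f. orthonormal_upto J P n f \<and>
    (\<forall>l<n. \<exists>c. \<forall>j\<in>J. f l j = lincomb n g c j) \<and>
    (\<forall>v. \<exists>d. (\<forall>j\<in>J. lincomb n g v j = lincomb n f d j))"
proof (induction n)
  case 0
  then show ?case by (auto simp: orthonormal_upto_def)
next
  case (Suc n)
  then obtain f where f: "orthonormal_upto J P n f"
    and fg: "\<forall>l<n. \<exists>c. \<forall>j\<in>J. f l j = lincomb n g c j"
    and gf: "\<forall>v. \<exists>d. \<forall>j\<in>J. lincomb n g v j = lincomb n f d j"
    by blast
  define e where "e l = (\<Sum>j\<in>J. P j * (f l j * g n j))" for l
  \<comment> \<open>The component of the new function orthogonal to the system built so far.\<close>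
  define u where "u j = g n j - lincomb n f e j" for j
  define s where "s = sqrt (wnorm2 J P u)"
  define f' where "f' = f(n := (\<lambda>j. u j / s))"
  have s0: "0 \<le> s" using wnorm2_nonneg[of J P u] P by (simp add: s_def less_imp_le)
  have s2: "s\<^sup>2 = wnorm2 J P u"
    using wnorm2_nonneg[of J P u] P by (simp add: s_def less_imp_le)
  have orth: "(\<Sum>j\<in>J. P j * (u j * f l j)) = 0" if l: "l < n" for l
  proof -
    have "(\<Sum>j\<in>J. P j * (u j * f l j)) = e l - (\<Sum>j\<in>J. P j * (lincomb n f e j * f l j))"
      by (simp add: u_def e_def algebra_simps sum_subtractf)
    also have "\<dots> = e l - e l * wnorm2 J P (f l)"
      using inner_lincomb_orthonormal[OF f l] by simp
    also have "\<dots> = 0"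
    proof -
      have "wnorm2 J P (f l) = 1 \<or> (\<forall>j\<in>J. f l j = 0)"
        using f l by (auto simp: orthonormal_upto_def)
      then show ?thesis by (auto simp: e_def)
    qed
    finally show ?thesis .
  qed
  have orth': "(\<Sum>j\<in>J. P j * (u j / s * f l j)) = 0" if l: "l < n" for l
    using orth[OF l] by (simp add: sum_divide_distrib[symmetric])
  have unit: "wnorm2 J P (\<lambda>j. u j / s) = 1 \<or> (\<forall>j\<in>J. u j / s = 0)"
  proof (cases "s = 0")
    case False
    have "wnorm2 J P (\<lambda>j. u j / s) = wnorm2 J P u / s\<^sup>2"
      by (simp add: wnorm2_def power_divide sum_divide_distrib)
    moreover have "wnorm2 J P u \<noteq> 0" using False s2 by auto
    ultimately show ?thesis using s2 by simp
  qed simp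
  have f'_orth: "orthonormal_upto J P (Suc n) f'"
    unfolding orthonormal_upto_def f'_def
    using f unit orth' orth'[unfolded mult.commute[of "u _ / s"]]
    by (auto simp: less_Suc_eq orthonormal_upto_def)
  have lincomb_f': "lincomb n f' v j = lincomb n f v j" for v j
    by (simp add: lincomb_def f'_def)
  have "\<exists>c. \<forall>j\<in>J. f' l j = lincomb (Suc n) g c j" if l: "l < Suc n" for l
  proof (cases "l = n")
    case False
    then obtain c where "\<forall>j\<in>J. f l j = lincomb n g c j" using fg l by (auto simp: less_Suc_eq)
    then have "\<forall>j\<in>J. f' l j = lincomb (Suc n) g (c(n := 0)) j"
      using False by (auto simp: f'_def lincomb_Suc cong: lincomb_cong)
    then show ?thesis by blast
  next
    case True
    obtain c where c: "\<And>j. j \<in> J \<Longrightarrow> lincomb n f e j = lincomb n g c j"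
      using lincomb_compose[of n J f n g e] fg by blast
    define c' where "c' k = (if k = n then 1 / s else - c k / s)" for k
    have "lincomb n g c' j = - lincomb n g c j / s" for j
      by (simp add: lincomb_def c'_def sum_negf sum_divide_distrib[symmetric])
    then have "f' l j = lincomb (Suc n) g c' j" if "j \<in> J" for j
      using that True c
      by (simp add: f'_def u_def lincomb_Suc diff_divide_distrib) (simp add: c'_def)
    then show ?thesis by blast
  qed
  moreover have "\<exists>d. \<forall>j\<in>J. lincomb (Suc n) g v j = lincomb (Suc n) f' d j" for v
  proof -
    obtain d where d: "\<forall>j\<in>J. lincomb n g v j = lincomb n f d j" using gf by blast
    have u: "u j = s * (u j / s)" if "j \<in> J" for j
    proof (cases "s = 0")
      case True
      then have "u j = 0"
        using s2 wnorm2_eq_0_imp[OF J P, where r = u and j = j] that by auto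
      then show ?thesis by simp
    qed simp
    have "lincomb (Suc n) g v j = lincomb (Suc n) f' (\<lambda>l. if l = n then v n * s else d l + v n * e l) j"
      if j: "j \<in> J" for j
    proof -
      have "g n j = u j + lincomb n f e j" by (simp add: u_def)
      then have "lincomb (Suc n) g v j = lincomb n f d j + v n * (u j + lincomb n f e j)"
        using d j by (simp add: lincomb_Suc)
      moreover have "lincomb n f (\<lambda>l. if l = n then v n * s else d l + v n * e l) j
          = lincomb n f d j + v n * lincomb n f e j"
        by (simp add: lincomb_add[symmetric] lincomb_scale[symmetric] cong: lincomb_cong)
      moreover have "v n * u j = v n * s * (u j / s)"
        using u[OF j] by (metis mult.assoc)
      ultimately show ?thesis
        unfolding lincomb_Suc lincomb_f' by (simp add: f'_def algebra_simps)
    qed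
    then show ?thesis by blast
  qed
  ultimately show ?case using f'_orth by blast
qed

text \<open>
  The coordinates at the zero functions are arbitrary; setting them to 0 gives Parseval's identity.
\<close>

lemma orthonormal_coordinates:
  assumes f: "orthonormal_upto J P n f"
  obtains d' where "\<And>j. j \<in> J \<Longrightarrow> lincomb n f d' j = lincomb n f d j"
    "(\<Sum>l<n. (d' l)\<^sup>2) = wnorm2 J P (lincomb n f d)"
proof -
  define d' where "d' l = d l * wnorm2 J P (f l)" for l
  have c: "wnorm2 J P (f l) = 1 \<or> (\<forall>j\<in>J. f l j = 0) \<and> wnorm2 J P (f l) = 0" if "l < n" for l
    using f that by (auto simp: orthonormal_upto_def wnorm2_def)
  have "lincomb n f d' j = lincomb n f d j" if "j \<in> J" for j
    unfolding lincomb_def d'_def using c that by (intro sum.cong) force+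
  moreover have "(\<Sum>l<n. (d' l)\<^sup>2) = wnorm2 J P (lincomb n f d)"
    unfolding wnorm2_lincomb_orthonormal[OF f] d'_def using c by (intro sum.cong) force+
  ultimately show ?thesis using that by blast
qed

text \<open>
  The sum \<open>\<Sum>\<^sub>l f\<^sub>l(j)\<^sup>2\<close> is the squared norm of evaluation at \<open>j\<close> on the span of the system: testing the
  comparison of sup norm and \<open>L\<^sup>2\<close> norm on the reproducing kernel \<open>\<Sum>\<^sub>l f\<^sub>l(j) f\<^sub>l\<close> bounds it.
\<close>

lemma orthonormal_leverage_le:
  assumes J: "finite J" and P: "\<And>j. j \<in> J \<Longrightarrow> 0 < P j"
    and f: "orthonormal_upto J P n f"
    and sup: "\<And>c j. j \<in> J \<Longrightarrow> (lincomb n f c j)\<^sup>2 \<le> B * wnorm2 J P (lincomb n f c)"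
    and j: "j \<in> J" and B: "0 \<le> B"
  shows "(\<Sum>l<n. (f l j)\<^sup>2) \<le> B"
proof -
  let ?b = "\<Sum>l<n. (f l j)\<^sup>2"
  have b: "lincomb n f (\<lambda>l. f l j) j = ?b"
    by (simp add: lincomb_def power2_eq_square)
  have "?b * ?b \<le> B * wnorm2 J P (lincomb n f (\<lambda>l. f l j))"
    using sup[OF j, of "\<lambda>l. f l j"] by (simp add: b power2_eq_square)
  also have "\<dots> \<le> B * ?b"
    using B by (intro mult_left_mono wnorm2_lincomb_orthonormal_le[OF f])
  finally show ?thesis
    using B by (metis mult_le_cancel_right_pos sum_nonneg zero_le_power2 order_le_less)
qed

lemma orthonormal_leverage_mean:
  assumes "orthonormal_upto J P n f"
  shows "(\<Sum>j\<in>J. P j * (\<Sum>l<n. (f l j)\<^sup>2)) \<le> real n"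
proof -
  have "(\<Sum>j\<in>J. P j * (\<Sum>l<n. (f l j)\<^sup>2)) = (\<Sum>j\<in>J. \<Sum>l<n. P j * (f l j)\<^sup>2)"
    by (simp add: sum_distrib_left)
  also have "\<dots> = (\<Sum>l<n. wnorm2 J P (f l))"
    by (subst sum.swap) (simp add: wnorm2_def)
  also have "\<dots> \<le> (\<Sum>l<n. 1)"
    using orthonormal_wnorm2_cases[OF assms] by (intro sum_mono) force
  finally show ?thesis by simp
qed

section \<open>Rounding to a lattice\<close>

text \<open>
  Coordinates are rounded to multiples of \<open>h\<close> one after the other. A concave quadratic in one coordinate
  loses at most its second order term when that coordinate moves in the direction in which its
  derivative does not decrease the value, so the total loss involves only the diagonal of the
  quadratic form, that is, an average of the leverages \<open>\<Sum>\<^sub>l f\<^sub>l(j)\<^sup>2\<close>. For random \<open>X\<close> this average is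
  a scalar that a Chernoff bound controls, unlike the operator norm of the quadratic form.
\<close>

lemma round_to_lattice:
  fixes X P :: "'a \<Rightarrow> real" and f :: "nat \<Rightarrow> 'a \<Rightarrow> real" and K :: nat
  assumes h: "0 < h" and X: "\<And>j. j \<in> J \<Longrightarrow> 0 \<le> X j"
  defines "Q \<equiv> \<lambda>w. (\<Sum>j\<in>J. X j * (lincomb K f w j - (lincomb K f w j)\<^sup>2 / 3)) - (\<Sum>j\<in>J. P j * lincomb K f w j)"
  shows "\<exists>z::nat \<Rightarrow> int. (\<forall>l<K. \<bar>h * z l - d l\<bar> \<le> h) \<and>
    Q d - h\<^sup>2 / 3 * (\<Sum>j\<in>J. X j * (\<Sum>l<K. (f l j)\<^sup>2)) \<le> Q (\<lambda>l. h * z l)"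
proof -
  have step: "Q (w(n := w n + \<delta>)) = Q w
      + \<delta> * ((\<Sum>j\<in>J. X j * (f n j * (1 - 2 * lincomb K f w j / 3))) - (\<Sum>j\<in>J. P j * f n j))
      - \<delta>\<^sup>2 / 3 * (\<Sum>j\<in>J. X j * (f n j)\<^sup>2)" if "n < K" for w n \<delta>
  proof -
    have "X j * ((a + \<delta> * f n j) - (a + \<delta> * f n j)\<^sup>2 / 3)
        = X j * (a - a\<^sup>2 / 3) + \<delta> * (X j * (f n j * (1 - 2 * a / 3))) - \<delta>\<^sup>2 / 3 * (X j * (f n j)\<^sup>2)" for j a
      by (simp add: power2_eq_square field_simps)
    moreover have "P j * (a + \<delta> * f n j) = P j * a + \<delta> * (P j * f n j)" for j a
      by (simp add: algebra_simps)
    ultimately show ?thesis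
      unfolding Q_def lincomb_update[OF that]
      by (simp only: sum.distrib sum_subtractf sum_distrib_left[symmetric]) (simp add: algebra_simps)
  qed
  have "\<exists>w. (\<forall>l<n. (\<exists>z::int. w l = h * z) \<and> \<bar>w l - d l\<bar> \<le> h) \<and> (\<forall>l\<ge>n. w l = d l) \<and>
      Q d - h\<^sup>2 / 3 * (\<Sum>l<n. \<Sum>j\<in>J. X j * (f l j)\<^sup>2) \<le> Q w" if "n \<le> K" for n
    using that
  proof (induction n)
    case 0
    show ?case by (intro exI[of _ d]) simp
  next
    case (Suc n)
    then obtain w where w: "\<forall>l<n. (\<exists>z::int. w l = h * z) \<and> \<bar>w l - d l\<bar> \<le> h" "\<forall>l\<ge>n. w l = d l"
      and Qw: "Q d - h\<^sup>2 / 3 * (\<Sum>l<n. \<Sum>j\<in>J. X j * (f l j)\<^sup>2) \<le> Q w"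
      by auto
    define \<beta> where "\<beta> = (\<Sum>j\<in>J. X j * (f n j * (1 - 2 * lincomb K f w j / 3))) - (\<Sum>j\<in>J. P j * f n j)"
    \<comment> \<open>\<open>\<beta>\<close> is the derivative in coordinate \<open>n\<close>; it decides between rounding up and down.\<close>
    define y where "y = (if 0 \<le> \<beta> then h * \<lceil>d n / h\<rceil> else h * \<lfloor>d n / h\<rfloor>)"
    define \<delta> where "\<delta> = y - d n"
    have \<delta>: "\<bar>\<delta>\<bar> \<le> h" "0 \<le> \<delta> * \<beta>"
    proof -
      have 1: "h * \<lceil>d n / h\<rceil> \<ge> d n" "h * \<lfloor>d n / h\<rfloor> \<le> d n"
      proof -
        have "h * \<lceil>d n / h\<rceil> \<ge> h * (d n / h)" "h * \<lfloor>d n / h\<rfloor> \<le> h * (d n / h)"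
          using h by (intro mult_left_mono; linarith)+
        then show "h * \<lceil>d n / h\<rceil> \<ge> d n" "h * \<lfloor>d n / h\<rfloor> \<le> d n"
          using h by simp_all
      qed
      have 2: "h * \<lceil>d n / h\<rceil> \<le> d n + h" "h * \<lfloor>d n / h\<rfloor> \<ge> d n - h"
      proof -
        have "h * \<lceil>d n / h\<rceil> \<le> h * (d n / h + 1)" "h * \<lfloor>d n / h\<rfloor> \<ge> h * (d n / h - 1)"
          using h by (intro mult_left_mono; linarith)+
        then show "h * \<lceil>d n / h\<rceil> \<le> d n + h" "h * \<lfloor>d n / h\<rfloor> \<ge> d n - h"
          using h by (simp_all add: distrib_left right_diff_distrib)
      qed
      show "\<bar>\<delta>\<bar> \<le> h" "0 \<le> \<delta> * \<beta>"
        using 1 2 by (auto simp: \<delta>_def y_def zero_le_mult_iff)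
    qed
    have \<delta>2: "\<delta>\<^sup>2 \<le> h\<^sup>2" using \<delta>(1) h by (simp add: abs_le_square_iff[symmetric])
    have a: "0 \<le> (\<Sum>j\<in>J. X j * (f n j)\<^sup>2)" using X by (intro sum_nonneg) auto
    have "Q w - h\<^sup>2 / 3 * (\<Sum>j\<in>J. X j * (f n j)\<^sup>2) \<le> Q (w(n := w n + \<delta>))"
      using Suc.prems step[of n w \<delta>] \<delta>(2) mult_right_mono[OF \<delta>2 a] by (simp add: \<beta>_def)
    moreover have "w n + \<delta> = y" using w(2) by (simp add: \<delta>_def)
    ultimately have "Q d - h\<^sup>2 / 3 * (\<Sum>l<Suc n. \<Sum>j\<in>J. X j * (f l j)\<^sup>2) \<le> Q (w(n := y))"
      using Qw by (simp add: distrib_left del: fun_upd_apply)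
    moreover have "\<exists>z::int. y = h * z" by (auto simp: y_def)
    moreover have "\<bar>y - d n\<bar> \<le> h" using \<delta>(1) by (simp add: \<delta>_def)
    ultimately show ?case
      using w by (intro exI[of _ "w(n := y)"]) (simp add: less_Suc_eq fun_upd_def)
  qed
  from this[of K] obtain w where w: "\<forall>l<K. (\<exists>z::int. w l = h * z) \<and> \<bar>w l - d l\<bar> \<le> h"
    and Qw: "Q d - h\<^sup>2 / 3 * (\<Sum>l<K. \<Sum>j\<in>J. X j * (f l j)\<^sup>2) \<le> Q w"
    by auto
  from w obtain z :: "nat \<Rightarrow> int" where z: "\<And>l. l < K \<Longrightarrow> w l = h * z l \<and> \<bar>w l - d l\<bar> \<le> h"
    by metis
  have "Q w = Q (\<lambda>l. h * z l)"
    unfolding Q_def using z by (simp cong: lincomb_cong)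
  moreover have "(\<Sum>l<K. \<Sum>j\<in>J. X j * (f l j)\<^sup>2) = (\<Sum>j\<in>J. X j * (\<Sum>l<K. (f l j)\<^sup>2))"
    by (subst sum.swap) (simp add: sum_distrib_left)
  ultimately show ?thesis
    using z Qw by (intro exI[of _ z]) (metis order_refl)
qed

text \<open>
  Each counted point \<open>z\<close> satisfies \<open>1 \<le> 2\<^sup>M \<Prod>\<^sub>l 2\<^bsup>-\<bar>z\<^sub>l\<bar>\<^esup>\<close>, and the right-hand side summed over all integer points
  factorises into \<open>K\<close> geometric series of sum 3.
\<close>

lemma card_lattice_l1_le:
  fixes Z :: "(nat \<Rightarrow> int) set"
  assumes Z: "Z \<subseteq> PiE {..<K} (\<lambda>_. UNIV)"
    and l1: "\<And>z. z \<in> Z \<Longrightarrow> (\<Sum>l<K. \<bar>z l\<bar>) \<le> int M"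
  shows "finite Z" "real (card Z) \<le> 2 ^ M * 3 ^ K"
proof -
  let ?B = "PiE {..<K} (\<lambda>_. {- int M..int M})"
  have sub: "Z \<subseteq> ?B"
  proof
    fix z assume z: "z \<in> Z"
    have "\<bar>z l\<bar> \<le> int M" if "l < K" for l
      using l1[OF z] member_le_sum[of l "{..<K}" "\<lambda>l. \<bar>z l\<bar>"] that by auto
    then have "z l \<in> {- int M..int M}" if "l < K" for l
      using that by (simp add: abs_le_iff minus_le_iff)
    then show "z \<in> ?B" using Z z by (auto simp: PiE_iff)
  qed
  then show fin: "finite Z" by (rule finite_subset) (intro finite_PiE; simp)
  have one: "(\<Sum>i\<in>{- int M..int M}. (1 / 2) ^ nat \<bar>i\<bar> :: real) \<le> 3"
  proof -
    have "(\<Sum>i\<in>{- int m..int m}. (1 / 2) ^ nat \<bar>i\<bar> :: real) = 3 - 2 * (1 / 2) ^ m" for m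
    proof (induction m)
      case (Suc m)
      have "{- int (Suc m)..int (Suc m)} = insert (- int (Suc m)) (insert (int (Suc m)) {- int m..int m})"
        by auto
      moreover have "nat \<bar>int (Suc m)\<bar> = Suc m" "nat \<bar>- int (Suc m)\<bar> = Suc m"
        by simp_all
      ultimately show ?case using Suc by (simp del: of_nat_Suc)
    qed simp
    then show ?thesis by simp
  qed
  have "real (card Z) = (\<Sum>z\<in>Z. 1)" by simp
  also have "\<dots> \<le> (\<Sum>z\<in>Z. 2 ^ M * (\<Prod>l<K. (1 / 2) ^ nat \<bar>z l\<bar>))"
  proof (rule sum_mono)
    fix z assume z: "z \<in> Z"
    have "(\<Sum>l<K. nat \<bar>z l\<bar>) \<le> M"
    proof -
      have "int (\<Sum>l<K. nat \<bar>z l\<bar>) = (\<Sum>l<K. \<bar>z l\<bar>)" by simp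
      then show ?thesis using l1[OF z] by linarith
    qed
    then have "(1 / 2 :: real) ^ M \<le> (1 / 2) ^ (\<Sum>l<K. nat \<bar>z l\<bar>)"
      by (intro power_decreasing) auto
    also have "\<dots> = (\<Prod>l<K. (1 / 2) ^ nat \<bar>z l\<bar>)"
      by (simp add: power_sum)
    finally have "2 ^ M * (1 / 2 :: real) ^ M \<le> 2 ^ M * (\<Prod>l<K. (1 / 2) ^ nat \<bar>z l\<bar>)"
      by (intro mult_left_mono) auto
    then show "1 \<le> 2 ^ M * (\<Prod>l<K. (1 / 2 :: real) ^ nat \<bar>z l\<bar>)"
      by (simp add: power_mult_distrib[symmetric])
  qed
  also have "\<dots> \<le> (\<Sum>z\<in>?B. 2 ^ M * (\<Prod>l<K. (1 / 2) ^ nat \<bar>z l\<bar>))"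
    using sub by (intro sum_mono2 finite_PiE mult_nonneg_nonneg prod_nonneg) simp_all
  also have "\<dots> = 2 ^ M * (\<Prod>l<K. \<Sum>i\<in>{- int M..int M}. (1 / 2) ^ nat \<bar>i\<bar>)"
    by (subst prod_sum_PiE) (simp_all add: sum_distrib_left)
  also have "\<dots> \<le> 2 ^ M * (\<Prod>l<K. 3)"
    by (intro mult_left_mono prod_mono conjI one sum_nonneg) simp_all
  finally show "real (card Z) \<le> 2 ^ M * 3 ^ K" by simp
qed

section \<open>Exceptional events\<close>

lemma prob_Bex_le:
  assumes "finite I" "\<And>i. i \<in> I \<Longrightarrow> measure_pmf.prob D {x. Q i x} \<le> c"
  shows "measure_pmf.prob D {x. \<exists>i\<in>I. Q i x} \<le> real (card I) * c"
proof -
  have "{x. \<exists>i\<in>I. Q i x} = (\<Union>i\<in>I. {x. Q i x})" by auto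
  then have "measure_pmf.prob D {x. \<exists>i\<in>I. Q i x} \<le> (\<Sum>i\<in>I. measure_pmf.prob D {x. Q i x})"
    using measure_pmf.finite_measure_subadditive_finite[OF assms(1), of "\<lambda>i. {x. Q i x}" D] by simp
  also have "\<dots> \<le> (\<Sum>i\<in>I. c)" using assms(2) by (rule sum_mono)
  finally show ?thesis by simp
qed

lemma sum_J_over:
  assumes "P \<in> prob_simplex p"
  shows "sum P (J_over p P) = 1"
proof -
  have "sum P (J_over p P) = sum P {..<p}"
    using assms by (intro sum.mono_neutral_left) (auto simp: J_over_def prob_simplex_def order_le_less)
  then show ?thesis using assms by (simp add: prob_simplex_def)
qed

text \<open>
  The form in which one-word moments are estimated: bound the exponential pointwise by
  \<open>1 + u\<close>, take means, and use \<open>1 + a \<le> exp a\<close>.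
\<close>

lemma mgf_le_exp:
  assumes P: "P \<in> prob_simplex p"
    and le: "\<And>j. j \<in> J_over p P \<Longrightarrow> exp (g j) \<le> 1 + u j"
    and a: "(\<Sum>j\<in>J_over p P. P j * u j) \<le> a"
  shows "(\<Sum>j\<in>J_over p P. P j * exp (g j)) \<le> exp a"
proof -
  have "(\<Sum>j\<in>J_over p P. P j * exp (g j)) \<le> (\<Sum>j\<in>J_over p P. P j * (1 + u j))"
    using le by (intro sum_mono mult_left_mono) (auto simp: J_over_def)
  also have "\<dots> = 1 + (\<Sum>j\<in>J_over p P. P j * u j)"
    by (simp add: distrib_left sum.distrib sum_J_over[OF P])
  also have "\<dots> \<le> exp a"
    using a exp_ge_add_one_self[of a] by linarith
  finally show ?thesis .
qed

text \<open>
  A word of \<^const>\<open>J_under\<close> satisfies \<open>N P\<^sub>j > 16 ln p\<close>, which is what makes the probability of losing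
  half of its mass at most \<open>1 / p\<^sup>2\<close>, small enough for a union bound over the words.
\<close>

lemma prob_frequent_word_halved_le:
  assumes P: "P \<in> prob_simplex p" and N: "1 \<le> N" and p: "1 < p"
  shows "measure_pmf.prob (frequency_pmf p N P) {X. \<exists>j\<in>J_under p N P. X j \<le> P j / 2} \<le> 1 / real p"
proof -
  have "measure_pmf.prob (frequency_pmf p N P) {X. X j \<le> P j / 2} \<le> 1 / (real p)\<^sup>2"
    if j: "j \<in> J_under p N P" for j
  proof -
    have lnp: "0 < ln (real p)" using p by simp
    have jp: "j < p" and eps: "P j > 2 * eps p N P j" using j by (auto simp: J_under_def)
    have P0: "0 \<le> P j" using P jp by (auto simp: prob_simplex_def)
    define e where "e = 4 * ln (real p) / (3 * real N)"
    define q where "q = sqrt (P j * ln (real p) / real N)"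
    have "0 \<le> e" using lnp by (simp add: e_def)
    moreover have "2 * (2 * q + e) < P j"
      using eps by (simp only: eps_def e_def q_def)
    ultimately have gt: "4 * q < P j"
      by argo
    have q: "0 \<le> q" "q\<^sup>2 = P j * ln (real p) / real N"
      using P0 lnp by (simp_all add: q_def)
    have Ppos: "0 < P j" using gt q(1) by argo
    have "(4 * q)\<^sup>2 < (P j)\<^sup>2"
      using gt q(1) by (intro power_strict_mono) auto
    then have "16 * (P j * ln (real p) / real N) < P j * P j"
      using q(2) by (simp add: power_mult_distrib power2_eq_square)
    then have big: "16 * ln (real p) < real N * P j"
      using Ppos N by (simp add: field_simps)
    have jJ: "j \<in> J_over p P" using jp Ppos by (simp add: J_over_def)
    let ?g = "\<lambda>i. if i = j then - 1 else 0 :: real"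
    have "measure_pmf.prob (frequency_pmf p N P) {X. - P j / 2 \<le> (\<Sum>i\<in>J_over p P. X i * ?g i)}
        \<le> exp (real N * (- 5 / 8 * P j - - P j / 2))"
    proof (rule prob_frequency_pmf_ge_le[OF P N], rule mgf_le_exp[OF P])
      show "exp (?g i) \<le> 1 + (if i = j then - 5 / 8 else 0)" for i
        using exp_minus_one_le by simp
      have "(\<Sum>i\<in>J_over p P. P i * (if i = j then - 5 / 8 else 0))
          = (\<Sum>i\<in>J_over p P. if i = j then - 5 / 8 * P j else 0)"
        by (intro sum.cong) auto
      then show "(\<Sum>i\<in>J_over p P. P i * (if i = j then - 5 / 8 else 0)) \<le> - 5 / 8 * P j"
        using jJ by simp
    qed
    moreover have "(\<Sum>i\<in>J_over p P. X i * ?g i) = - X j" for X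
    proof -
      have "(\<Sum>i\<in>J_over p P. X i * ?g i) = (\<Sum>i\<in>J_over p P. if i = j then - X j else 0)"
        by (intro sum.cong) auto
      then show ?thesis using jJ by simp
    qed
    moreover have "exp (real N * (- 5 / 8 * P j - - P j / 2)) \<le> exp (- 2 * ln (real p))"
      using big by simp
    ultimately have "measure_pmf.prob (frequency_pmf p N P) {X. X j \<le> P j / 2} \<le> exp (- 2 * ln (real p))"
      by (auto intro: order_trans)
    moreover have "exp (- 2 * ln (real p)) = 1 / (real p)\<^sup>2"
    proof -
      have "exp (- 2 * ln (real p)) = inverse (exp (ln (real p)) ^ 2)"
        by (simp add: exp_minus exp_double)
      then show ?thesis using p by (simp add: inverse_eq_divide)
    qed
    ultimately show ?thesis by simp
  qed
  then have "measure_pmf.prob (frequency_pmf p N P) {X. \<exists>j\<in>J_under p N P. X j \<le> P j / 2}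
      \<le> real (card (J_under p N P)) * (1 / (real p)\<^sup>2)"
    by (intro prob_Bex_le) (auto simp: J_under_def)
  also have "\<dots> \<le> real p * (1 / (real p)\<^sup>2)"
  proof (intro mult_right_mono of_nat_mono)
    show "card (J_under p N P) \<le> p"
      using card_mono[of "{..<p}" "J_under p N P"] by (auto simp: J_under_def)
  qed simp
  also have "\<dots> = 1 / real p" by (simp add: power2_eq_square)
  finally show ?thesis .
qed

text \<open>
  Bernstein's inequality in the range \<open>m L \<le> N\<close>, where the Gaussian part of the tail dominates.
\<close>

lemma prob_bernstein_le:
  assumes P: "P \<in> prob_simplex p" and N: "1 \<le> N"
    and g: "\<And>j. j \<in> J_over p P \<Longrightarrow> \<bar>g j\<bar> \<le> m" and var: "wnorm2 (J_over p P) P g \<le> m"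
    and L: "0 < L" and m: "0 < m" and mL: "m * L \<le> real N"
  shows "measure_pmf.prob (frequency_pmf p N P)
      {X. 3 * sqrt (m * L / real N) \<le> (\<Sum>j\<in>J_over p P. X j * g j) - (\<Sum>j\<in>J_over p P. P j * g j)}
    \<le> exp (- 2 * L)"
proof -
  let ?J = "J_over p P"
  \<comment> \<open>With \<open>N m \<theta>\<^sup>2 = L\<close> the Chernoff exponent \<open>N (m \<theta>\<^sup>2 - 3 m \<theta>\<^sup>2)\<close> equals \<open>-2L\<close>.\<close>
  define \<theta> where "\<theta> = sqrt (L / (real N * m))"
  have \<theta>: "0 < \<theta>" using L N m by (simp add: \<theta>_def)
  have \<theta>2: "\<theta>\<^sup>2 = L / (real N * m)" using L N m by (simp add: \<theta>_def)
  have "(\<theta> * m)\<^sup>2 \<le> 1\<^sup>2"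
    unfolding power_mult_distrib \<theta>2 using mL N m by (simp add: power2_eq_square field_simps)
  then have \<theta>m: "\<theta> * m \<le> 1" by (rule power2_le_imp_le) simp
  have dev: "sqrt (m * L / real N) = \<theta> * m"
  proof -
    have "m * L / real N = L / (real N * m) * m\<^sup>2" using m by (simp add: power2_eq_square)
    then have "sqrt (m * L / real N) = \<theta> * sqrt (m\<^sup>2)"
      by (simp only: \<theta>_def real_sqrt_mult)
    then show ?thesis using m by simp
  qed
  let ?a = "\<theta> * (\<Sum>j\<in>?J. P j * g j) + \<theta>\<^sup>2 * m"
  let ?t = "\<theta> * (3 * sqrt (m * L / real N) + (\<Sum>j\<in>?J. P j * g j))"
  have "measure_pmf.prob (frequency_pmf p N P) {X. ?t \<le> (\<Sum>j\<in>?J. X j * (\<theta> * g j))}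
      \<le> exp (real N * (?a - ?t))"
  proof (rule prob_frequency_pmf_ge_le[OF P N], rule mgf_le_exp[OF P])
    fix j assume j: "j \<in> ?J"
    have "\<theta> * g j \<le> \<theta> * m" using g[OF j] \<theta> by (intro mult_left_mono) auto
    then show "exp (\<theta> * g j) \<le> 1 + (\<theta> * g j + (\<theta> * g j)\<^sup>2)"
      using exp_le_quadratic[of "\<theta> * g j"] \<theta>m by simp
  next
    have "(\<Sum>j\<in>?J. P j * (\<theta> * g j + (\<theta> * g j)\<^sup>2)) = \<theta> * (\<Sum>j\<in>?J. P j * g j) + \<theta>\<^sup>2 * wnorm2 ?J P g"
      by (simp add: wnorm2_def distrib_left sum.distrib sum_distrib_left power_mult_distrib mult_ac)
    also have "\<dots> \<le> ?a" using var by (intro add_left_mono mult_left_mono) auto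
    finally show "(\<Sum>j\<in>?J. P j * (\<theta> * g j + (\<theta> * g j)\<^sup>2)) \<le> ?a" .
  qed
  also have "real N * (?a - ?t) = - 2 * (real N * m * \<theta>\<^sup>2)"
    unfolding dev by (simp add: power2_eq_square algebra_simps)
  also have "\<dots> = - 2 * L" using N m by (simp add: \<theta>2)
  also have "{X. ?t \<le> (\<Sum>j\<in>?J. X j * (\<theta> * g j))}
     = {X. 3 * sqrt (m * L / real N) \<le> (\<Sum>j\<in>?J. X j * g j) - (\<Sum>j\<in>?J. P j * g j)}"
  proof -
    have "(\<Sum>j\<in>?J. X j * (\<theta> * g j)) = \<theta> * (\<Sum>j\<in>?J. X j * g j)" for X
      by (simp add: sum_distrib_left mult_ac)
    then show ?thesis using \<theta> by (auto simp: le_diff_eq)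
  qed
  finally show ?thesis .
qed

lemma prob_nonneg_mean_large_le:
  assumes P: "P \<in> prob_simplex p" and N: "1 \<le> N"
    and b: "\<And>j. j \<in> J_over p P \<Longrightarrow> 0 \<le> b j \<and> b j \<le> B"
    and mean: "(\<Sum>j\<in>J_over p P. P j * b j) \<le> \<mu>"
    and B: "0 < B"
  shows "measure_pmf.prob (frequency_pmf p N P) {X. 3 * \<mu> \<le> (\<Sum>j\<in>J_over p P. X j * b j)}
    \<le> exp (- real N * \<mu> / B)"
proof -
  let ?J = "J_over p P"
  have "measure_pmf.prob (frequency_pmf p N P) {X. 3 * \<mu> / B \<le> (\<Sum>j\<in>?J. X j * (b j / B))}
      \<le> exp (real N * (2 * \<mu> / B - 3 * \<mu> / B))"
  proof (rule prob_frequency_pmf_ge_le[OF P N], rule mgf_le_exp[OF P])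
    fix j assume j: "j \<in> ?J"
    have y: "0 \<le> b j / B" "b j / B \<le> 1" using b[OF j] B by auto
    then have "(b j / B)\<^sup>2 \<le> b j / B"
      unfolding power2_eq_square by (rule mult_left_le[rotated])
    then show "exp (b j / B) \<le> 1 + 2 * (b j / B)"
      using exp_le_quadratic[OF y(2)] by linarith
  next
    have "(\<Sum>j\<in>?J. P j * (2 * (b j / B))) = 2 * (\<Sum>j\<in>?J. P j * b j) / B"
      by (simp add: sum_distrib_left sum_divide_distrib mult_ac)
    also have "\<dots> \<le> 2 * \<mu> / B" using mean B by (intro divide_right_mono) auto
    finally show "(\<Sum>j\<in>?J. P j * (2 * (b j / B))) \<le> 2 * \<mu> / B" .
  qed
  also have "{X. 3 * \<mu> / B \<le> (\<Sum>j\<in>?J. X j * (b j / B))} = {X. 3 * \<mu> \<le> (\<Sum>j\<in>?J. X j * b j)}"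
    using B by (simp add: sum_divide_distrib[symmetric] divide_le_cancel)
  also have "real N * (2 * \<mu> / B - 3 * \<mu> / B) = - real N * \<mu> / B"
    using B by (simp add: field_simps)
  finally show ?thesis .
qed

text \<open>
  The lattice points that can arise from rounding a function of norm \<open>\<rho>\<close> bounded by 1/4 (see
  \<open>fine_rate\<close>): few enough for a union bound, of norm close to \<open>\<rho>\<close>, and carrying little norm where
  they are large. The last property is what the indicator in \<open>exp_penalised_le\<close> requires.
\<close>

definition lattice_net ::
  "'a set \<Rightarrow> ('a \<Rightarrow> real) \<Rightarrow> nat \<Rightarrow> (nat \<Rightarrow> 'a \<Rightarrow> real) \<Rightarrow> real \<Rightarrow> real \<Rightarrow> (nat \<Rightarrow> int) set" where
  "lattice_net J P K f h \<rho> = {z \<in> PiE {..<K} (\<lambda>_. UNIV).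
     (\<Sum>l<K. \<bar>z l\<bar>) \<le> int (41 * K) \<and>
     (39 / 40 * \<rho>)\<^sup>2 \<le> wnorm2 J P (lincomb K f (\<lambda>l. h * z l)) \<and>
     (\<Sum>j\<in>J. P j * (if \<bar>lincomb K f (\<lambda>l. h * z l) j\<bar> > 1 / 2 then (lincomb K f (\<lambda>l. h * z l) j)\<^sup>2 else 0))
       \<le> 4 * (\<rho> / 40)\<^sup>2}"

text \<open>
  With \<open>r\<close> the relative error of the fitted word probabilities, this bounds the log-likelihood
  ratio from above when \<open>r\<close> is small, up to the linear term in \<open>P\<close>. That term has a favourable
  sign at the estimator; keeping it centres the statistic, which lattice points need because
  for them the mean of \<open>r\<close> has no sign.
\<close>

definition excess :: "'a set \<Rightarrow> ('a \<Rightarrow> real) \<Rightarrow> ('a \<Rightarrow> real) \<Rightarrow> ('a \<Rightarrow> real) \<Rightarrow> real" where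
  "excess J P X r = (\<Sum>j\<in>J. X j * (r j - (r j)\<^sup>2 / 3)) - (\<Sum>j\<in>J. P j * r j)"

text \<open>
  At a fixed lattice point the excess has mean of order \<open>-\<rho>\<^sup>2\<close>, and it exceeds \<open>-(\<rho>/40)\<^sup>2\<close> with probability
  at most \<open>exp(-N \<rho>\<^sup>2/100)\<close>. Since \<open>N \<rho>\<^sup>2\<close> is a large multiple of \<open>K\<close>, this beats the \<open>exp(O(K))\<close> points of
  the net.
\<close>

lemma prob_lattice_excess_le:
  assumes P: "P \<in> prob_simplex p" and N: "1 \<le> N" and K: "1 \<le> K"
    and \<rho>: "10000 * real K \<le> real N * \<rho>\<^sup>2"
  shows "measure_pmf.prob (frequency_pmf p N P)
     {X. \<exists>z\<in>lattice_net (J_over p P) P K f h \<rho>.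
        - (\<rho> / 40)\<^sup>2 \<le> excess (J_over p P) P X (lincomb K f (\<lambda>l. h * z l))} \<le> exp (- real K)"
proof -
  let ?J = "J_over p P"
  let ?Net = "lattice_net ?J P K f h \<rho>"
  let ?bad = "\<lambda>z X. - (\<rho> / 40)\<^sup>2 \<le> excess ?J P X (lincomb K f (\<lambda>l. h * z l))"
  have each: "measure_pmf.prob (frequency_pmf p N P) {X. ?bad z X} \<le> exp (- 100 * real K)"
    if z: "z \<in> ?Net" for z
  proof -
    define r where "r = lincomb K f (\<lambda>l. h * z l)"
    define tail where "tail j = (if \<bar>r j\<bar> > 1 / 2 then (r j)\<^sup>2 else 0)" for j
    have big: "(39 / 40 * \<rho>)\<^sup>2 \<le> wnorm2 ?J P r" and small: "(\<Sum>j\<in>?J. P j * tail j) \<le> 4 * (\<rho> / 40)\<^sup>2"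
      using z unfolding lattice_net_def r_def tail_def by blast+
    let ?a = "(\<Sum>j\<in>?J. P j * r j) / 10 - wnorm2 ?J P r / 60 + 4 * (\<rho> / 40)\<^sup>2"
    let ?t = "((\<Sum>j\<in>?J. P j * r j) - (\<rho> / 40)\<^sup>2) / 10"
    have "measure_pmf.prob (frequency_pmf p N P) {X. ?t \<le> (\<Sum>j\<in>?J. X j * ((r j - (r j)\<^sup>2 / 3) / 10))}
        \<le> exp (real N * (?a - ?t))"
    proof (rule prob_frequency_pmf_ge_le[OF P N], rule mgf_le_exp[OF P])
      show "exp ((r j - (r j)\<^sup>2 / 3) / 10) \<le> 1 + (r j / 10 - (r j)\<^sup>2 / 60 + tail j)" for j
        using exp_penalised_le[of "r j"] unfolding tail_def by linarith
      have "(\<Sum>j\<in>?J. P j * (r j / 10 - (r j)\<^sup>2 / 60 + tail j))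
          = (\<Sum>j\<in>?J. P j * r j) / 10 - wnorm2 ?J P r / 60 + (\<Sum>j\<in>?J. P j * tail j)"
        by (simp add: wnorm2_def distrib_left right_diff_distrib sum.distrib sum_subtractf
            flip: sum_divide_distrib)
      then show "(\<Sum>j\<in>?J. P j * (r j / 10 - (r j)\<^sup>2 / 60 + tail j)) \<le> ?a"
        using small by linarith
    qed
    also have "{X. ?t \<le> (\<Sum>j\<in>?J. X j * ((r j - (r j)\<^sup>2 / 3) / 10))} = {X. ?bad z X}"
    proof -
      have eq: "(\<Sum>j\<in>?J. X j * ((r j - (r j)\<^sup>2 / 3) / 10)) = (\<Sum>j\<in>?J. X j * (r j - (r j)\<^sup>2 / 3)) / 10" for X
        by (simp add: sum_divide_distrib)
      show ?thesis
        unfolding excess_def r_def[symmetric] eq by (intro Collect_cong iffI; argo)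
    qed
    also have "exp (real N * (?a - ?t)) \<le> exp (- 100 * real K)"
    proof -
      have "(39 / 40 * \<rho>)\<^sup>2 = 1521 / 1600 * \<rho>\<^sup>2" "(\<rho> / 40)\<^sup>2 = \<rho>\<^sup>2 / 1600"
        by (simp_all add: power2_eq_square)
      then have "?a - ?t \<le> - \<rho>\<^sup>2 / 100"
        using big zero_le_power2[of \<rho>] by argo
      then have "real N * (?a - ?t) \<le> real N * (- \<rho>\<^sup>2 / 100)"
        by (rule mult_left_mono) simp
      also have "\<dots> \<le> - 100 * real K" using \<rho> by simp
      finally show ?thesis by (simp only: exp_le_cancel_iff)
    qed
    finally show ?thesis .
  qed
  have sub: "?Net \<subseteq> PiE {..<K} (\<lambda>_. UNIV)" and l1: "z \<in> ?Net \<Longrightarrow> (\<Sum>l<K. \<bar>z l\<bar>) \<le> int (41 * K)" for z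
    by (auto simp: lattice_net_def)
  note card = card_lattice_l1_le[OF sub l1]
  have "measure_pmf.prob (frequency_pmf p N P) {X. \<exists>z\<in>?Net. ?bad z X} \<le> real (card ?Net) * exp (- 100 * real K)"
    using card(1) each by (rule prob_Bex_le)
  also have "\<dots> \<le> 2 ^ (41 * K) * 3 ^ K * exp (- 100 * real K)"
    using card(2) by (intro mult_right_mono) auto
  also have "\<dots> \<le> exp (real (41 * K)) * exp (2 * real K) * exp (- 100 * real K)"
  proof -
    have "(2::real) \<le> exp 1" "(3::real) \<le> exp 2"
      using exp_ge_add_one_self[of 1] exp_ge_add_one_self[of 2] by simp_all
    then have "(2::real) ^ (41 * K) \<le> exp 1 ^ (41 * K)" "(3::real) ^ K \<le> exp 2 ^ K"
      by (intro power_mono; simp)+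
    moreover have "exp 1 ^ (41 * K) = exp (real (41 * K))"
      by (metis exp_of_nat_mult mult.right_neutral)
    moreover have "exp 2 ^ K = exp (2 * real K)"
      by (rule exp_of_nat2_mult[symmetric])
    ultimately show ?thesis by (intro mult_mono) auto
  qed
  also have "\<dots> \<le> exp (- real K)"
    by (simp add: exp_add[symmetric])
  finally show ?thesis .
qed

section \<open>From the likelihood inequality to error bounds\<close>

text \<open>
  Concavity of the likelihood: it is still at least its value at the truth after the error has been
  shrunk by a factor \<open>t\<close>, so errors may be scaled into the range of the quadratic bound on \<open>ln\<close>.
\<close>

lemma quadratic_lik_nonneg:
  fixes X r :: "'a \<Rightarrow> real"
  assumes X: "\<And>j. j \<in> J \<Longrightarrow> 0 \<le> X j" and t: "0 \<le> t" "t \<le> 1"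
    and r: "\<And>j. j \<in> J \<Longrightarrow> 0 < X j \<Longrightarrow> - 1 < r j"
    and lik: "0 \<le> (\<Sum>j\<in>J. X j * ln (1 + r j))"
    and small: "\<And>j. j \<in> J \<Longrightarrow> \<bar>t * r j\<bar> \<le> 1 / 4"
  shows "0 \<le> (\<Sum>j\<in>J. X j * (t * r j - (t * r j)\<^sup>2 / 3))"
proof -
  have "0 \<le> t * (\<Sum>j\<in>J. X j * ln (1 + r j))" using t lik by simp
  also have "\<dots> = (\<Sum>j\<in>J. X j * (t * ln (1 + r j)))"
    by (simp add: sum_distrib_left mult_ac)
  also have "\<dots> \<le> (\<Sum>j\<in>J. X j * (t * r j - (t * r j)\<^sup>2 / 3))"
  proof (rule sum_mono)
    fix j assume j: "j \<in> J"
    show "X j * (t * ln (1 + r j)) \<le> X j * (t * r j - (t * r j)\<^sup>2 / 3)"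
    proof (cases "0 < X j")
      case True
      have "- ln ((1 - t) * 1 + t * (1 + r j)) \<le> (1 - t) * (- ln 1) + t * (- ln (1 + r j))"
        using convex_onD[OF ln_concave[unfolded concave_on_def], of t 1 "1 + r j"] t r[OF j True] by simp
      then have "t * ln (1 + r j) \<le> ln (1 + t * r j)"
        by (simp add: algebra_simps)
      also have "\<dots> \<le> t * r j - (t * r j)\<^sup>2 / 3"
        using small[OF j] by (rule ln_one_plus_le_quadratic)
      finally show ?thesis using True by simp
    next
      case False
      then have "X j = 0" using X[OF j] by simp
      then show ?thesis by simp
    qed
  qed
  finally show ?thesis .
qed

lemma sum_mult_lincomb: "(\<Sum>j\<in>J. X j * lincomb K g v j) = (\<Sum>k<K. v k * (\<Sum>j\<in>J. X j * g k j))"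
proof -
  have "(\<Sum>j\<in>J. X j * lincomb K g v j) = (\<Sum>j\<in>J. \<Sum>k<K. v k * (X j * g k j))"
    by (simp add: lincomb_def sum_distrib_left mult_ac)
  then show ?thesis by (subst (asm) sum.swap) (simp add: sum_distrib_left)
qed

lemma abs_lincomb_le:
  assumes "\<And>k. k < K \<Longrightarrow> \<bar>g k j\<bar> \<le> m"
  shows "\<bar>lincomb K g v j\<bar> \<le> m * norm1 {..<K} v"
proof -
  have "\<bar>lincomb K g v j\<bar> \<le> (\<Sum>k<K. \<bar>v k * g k j\<bar>)"
    unfolding lincomb_def by (rule sum_abs)
  also have "\<dots> \<le> (\<Sum>k<K. m * \<bar>v k\<bar>)"
  proof (rule sum_mono)
    fix k assume "k \<in> {..<K}"
    then have "\<bar>v k\<bar> * \<bar>g k j\<bar> \<le> \<bar>v k\<bar> * m" using assms by (intro mult_left_mono) auto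
    then show "\<bar>v k * g k j\<bar> \<le> m * \<bar>v k\<bar>" by (simp add: abs_mult mult.commute)
  qed
  finally show ?thesis by (simp add: norm1_def sum_distrib_left)
qed

lemma weighted_l1_le_l2:
  assumes "\<And>j. j \<in> U \<Longrightarrow> 0 \<le> P j" "sum P U \<le> 1"
  shows "(\<Sum>j\<in>U. P j * \<bar>r j\<bar>)\<^sup>2 \<le> wnorm2 U P r"
proof -
  have "(\<Sum>j\<in>U. P j * (\<bar>r j\<bar> * 1))\<^sup>2 \<le> wnorm2 U P (\<lambda>j. \<bar>r j\<bar>) * wnorm2 U P (\<lambda>_. 1)"
    using assms(1) by (rule weighted_cauchy_schwarz)
  also have "\<dots> \<le> wnorm2 U P (\<lambda>j. \<bar>r j\<bar>) * 1"
    using assms by (intro mult_left_mono wnorm2_nonneg) (auto simp: wnorm2_def)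
  finally show ?thesis by (simp add: wnorm2_def)
qed

text \<open>
  A first localisation of the error \<open>v\<close>, at the scale at which the relative errors \<open>r\<close> drop below 1/4.
  If \<open>v\<close> were larger, shrink it to this scale exactly: there the quadratic term is at least of order
  \<open>\<kappa>\<^sup>2 \<parallel>v\<parallel>\<^sub>1\<^sup>2\<close>, using only the words in \<open>U\<close>, whereas the linear term is at most \<open>\<epsilon> \<parallel>v\<parallel>\<^sub>1\<close>.
\<close>

lemma crude_rate:
  fixes X P :: "'a \<Rightarrow> real" and g :: "nat \<Rightarrow> 'a \<Rightarrow> real" and v :: "nat \<Rightarrow> real" and K :: nat
  defines "r \<equiv> lincomb K g v"
  assumes J: "finite J" and P: "\<And>j. j \<in> J \<Longrightarrow> 0 < P j" "sum P J \<le> 1"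
    and X: "\<And>j. j \<in> J \<Longrightarrow> 0 \<le> X j" and U: "U \<subseteq> J" "\<And>j. j \<in> U \<Longrightarrow> P j / 2 \<le> X j"
    and g: "\<And>j k. j \<in> J \<Longrightarrow> k < K \<Longrightarrow> \<bar>g k j\<bar> \<le> m" and m: "0 < m"
    and noise: "\<And>k. k < K \<Longrightarrow> \<bar>(\<Sum>j\<in>J. X j * g k j) - (\<Sum>j\<in>J. P j * g k j)\<bar> \<le> \<epsilon>"
    and comp: "0 \<le> \<kappa>" "\<kappa> * norm1 {..<K} v \<le> (\<Sum>j\<in>U. P j * \<bar>r j\<bar>)"
    and drift: "(\<Sum>j\<in>J. P j * r j) \<le> 0"
    and pos: "\<And>j. j \<in> J \<Longrightarrow> 0 < X j \<Longrightarrow> - 1 < r j"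
    and lik: "0 \<le> (\<Sum>j\<in>J. X j * ln (1 + r j))"
    and small: "24 * \<epsilon> * m < \<kappa>\<^sup>2"
  shows "norm1 {..<K} v \<le> 1 / (4 * m)"
proof (rule ccontr)
  define D where "D = norm1 {..<K} v"
  assume "\<not> norm1 {..<K} v \<le> 1 / (4 * m)"
  then have D: "1 / (4 * m) < D" by (simp add: D_def)
  moreover have "0 < 1 / (4 * m)" using m by simp
  ultimately have D0: "0 < D" by (rule less_trans[rotated])
  define t where "t = 1 / (4 * m * D)"
  have "1 < D * (4 * m)" using D m by (simp add: pos_divide_less_eq)
  then have t: "0 < t" "t \<le> 1" "t * D = 1 / (4 * m)"
    using D0 m by (simp_all add: t_def mult.commute pos_divide_le_eq)
  have "\<bar>t * r j\<bar> \<le> 1 / 4" if j: "j \<in> J" for j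
  proof -
    have "\<bar>r j\<bar> \<le> m * D" unfolding r_def D_def using g[OF j] by (rule abs_lincomb_le)
    then have "t * \<bar>r j\<bar> \<le> t * (m * D)" using t by (intro mult_left_mono) auto
    also have "\<dots> = (t * D) * m" by simp
    also have "\<dots> = 1 / 4" unfolding t(3) using m by simp
    finally show ?thesis using t by (simp add: abs_mult)
  qed
  then have "0 \<le> (\<Sum>j\<in>J. X j * (t * r j - (t * r j)\<^sup>2 / 3))"
    using X t pos lik by (intro quadratic_lik_nonneg) auto
  also have "\<dots> = t * ((\<Sum>j\<in>J. X j * r j) - t / 3 * (\<Sum>j\<in>J. X j * (r j)\<^sup>2))"
  proof -
    have "X j * (t * r j - (t * r j)\<^sup>2 / 3) = t * (X j * r j) - t * (t / 3 * (X j * (r j)\<^sup>2))" for j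
      by (simp add: power2_eq_square algebra_simps)
    then show ?thesis
      by (simp only: sum_subtractf sum_distrib_left right_diff_distrib)
  qed
  finally have "t * 0 \<le> t * ((\<Sum>j\<in>J. X j * r j) - t / 3 * (\<Sum>j\<in>J. X j * (r j)\<^sup>2))"
    by (simp only: mult_zero_right)
  then have "0 \<le> (\<Sum>j\<in>J. X j * r j) - t / 3 * (\<Sum>j\<in>J. X j * (r j)\<^sup>2)"
    using t(1) by (rule mult_left_le_imp_le)
  then have quad: "t / 3 * (\<Sum>j\<in>J. X j * (r j)\<^sup>2) \<le> (\<Sum>j\<in>J. X j * r j)"
    by (simp only: diff_ge_0_iff_ge)
  have "(\<Sum>j\<in>J. X j * r j) \<le> (\<Sum>j\<in>J. X j * r j) - (\<Sum>j\<in>J. P j * r j)"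
    using drift by simp
  also have "\<dots> = (\<Sum>k<K. v k * ((\<Sum>j\<in>J. X j * g k j) - (\<Sum>j\<in>J. P j * g k j)))"
    unfolding r_def sum_mult_lincomb by (simp only: sum_subtractf right_diff_distrib)
  also have "\<dots> \<le> (\<Sum>k<K. \<bar>v k\<bar> * \<epsilon>)"
  proof (rule sum_mono)
    fix k assume "k \<in> {..<K}"
    then have "\<bar>v k\<bar> * \<bar>(\<Sum>j\<in>J. X j * g k j) - (\<Sum>j\<in>J. P j * g k j)\<bar> \<le> \<bar>v k\<bar> * \<epsilon>"
      using noise by (intro mult_left_mono) auto
    then show "v k * ((\<Sum>j\<in>J. X j * g k j) - (\<Sum>j\<in>J. P j * g k j)) \<le> \<bar>v k\<bar> * \<epsilon>"
      unfolding abs_mult[symmetric] by (rule order_trans[OF abs_ge_self])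
  qed
  also have "\<dots> = D * \<epsilon>" by (simp add: D_def norm1_def sum_distrib_right)
  finally have upper: "(\<Sum>j\<in>J. X j * r j) \<le> D * \<epsilon>" .
  have P0: "0 \<le> P j" if "j \<in> J" for j using P(1)[OF that] by simp
  have "(\<kappa> * D)\<^sup>2 \<le> (\<Sum>j\<in>U. P j * \<bar>r j\<bar>)\<^sup>2"
    using comp D0 by (intro power_mono) (auto simp: D_def)
  also have "\<dots> \<le> wnorm2 U P r"
  proof (rule weighted_l1_le_l2)
    show "sum P U \<le> 1"
    proof -
      have "sum P U \<le> sum P J" using U(1) P0 by (intro sum_mono2[OF J]) auto
      then show ?thesis using P(2) by simp
    qed
  qed (use U P0 in auto)
  also have "\<dots> \<le> (\<Sum>j\<in>U. 2 * (X j * (r j)\<^sup>2))"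
    unfolding wnorm2_def
  proof (rule sum_mono)
    fix j assume "j \<in> U"
    then have "P j \<le> 2 * X j" using U(2)[of j] by simp
    then have "P j * (r j)\<^sup>2 \<le> (2 * X j) * (r j)\<^sup>2" by (rule mult_right_mono) simp
    then show "P j * (r j)\<^sup>2 \<le> 2 * (X j * (r j)\<^sup>2)" by simp
  qed
  also have "\<dots> \<le> (\<Sum>j\<in>J. 2 * (X j * (r j)\<^sup>2))"
    using U J X by (intro sum_mono2) auto
  also have "\<dots> = 2 * (\<Sum>j\<in>J. X j * (r j)\<^sup>2)" by (simp add: sum_distrib_left)
  finally have lower: "(\<kappa> * D)\<^sup>2 \<le> 2 * (\<Sum>j\<in>J. X j * (r j)\<^sup>2)" .
  have "t / 6 * (\<kappa> * D)\<^sup>2 \<le> t / 6 * (2 * (\<Sum>j\<in>J. X j * (r j)\<^sup>2))"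
    using lower t by (intro mult_left_mono) auto
  also have "\<dots> = t / 3 * (\<Sum>j\<in>J. X j * (r j)\<^sup>2)" by simp
  also note quad
  also note upper
  also have "t / 6 * (\<kappa> * D)\<^sup>2 = D * ((t * D) * \<kappa>\<^sup>2 / 6)"
    by (simp add: power2_eq_square)
  finally have "1 / (4 * m) * \<kappa>\<^sup>2 / 6 \<le> \<epsilon>"
    unfolding t(3) using D0 by (rule mult_left_le_imp_le)
  then have "\<kappa>\<^sup>2 \<le> 24 * \<epsilon> * m" using m by (simp add: field_simps)
  then show False using small by simp
qed

text \<open>
  If the norm exceeded \<open>\<rho>\<close>, shrink the error to norm \<open>\<rho>\<close>: its excess remains nonnegative. Rounding its
  coordinates to the lattice then gives a point of the net whose excess is at least \<open>-(\<rho>/40)\<^sup>2\<close>, which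
  was excluded. The mesh \<open>h\<close> is chosen such that \<open>K h\<^sup>2 = (\<rho>/40)\<^sup>2\<close>, so that both the rounding error in
  norm and the loss in excess are small compared with \<open>\<rho>\<close> and \<open>\<rho>\<^sup>2\<close>.
\<close>

lemma fine_rate:
  fixes X P r :: "'a \<Rightarrow> real" and f :: "nat \<Rightarrow> 'a \<Rightarrow> real"
  assumes J: "finite J" and P: "\<And>j. j \<in> J \<Longrightarrow> 0 < P j"
    and X: "\<And>j. j \<in> J \<Longrightarrow> 0 \<le> X j"
    and f: "orthonormal_upto J P K f" and K: "1 \<le> K" and \<rho>: "0 < \<rho>"
    and leverage: "(\<Sum>j\<in>J. X j * (\<Sum>l<K. (f l j)\<^sup>2)) \<le> 3 * real K"
    and net: "\<And>z. z \<in> lattice_net J P K f (\<rho> / (40 * sqrt (real K))) \<rho> \<Longrightarrow>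
      excess J P X (lincomb K f (\<lambda>l. \<rho> / (40 * sqrt (real K)) * z l)) < - (\<rho> / 40)\<^sup>2"
    and r: "\<And>j. j \<in> J \<Longrightarrow> r j = lincomb K f d j"
    and r_small: "\<And>j. j \<in> J \<Longrightarrow> \<bar>r j\<bar> \<le> 1 / 4"
    and drift: "(\<Sum>j\<in>J. P j * r j) \<le> 0"
    and lik: "0 \<le> (\<Sum>j\<in>J. X j * ln (1 + r j))"
  shows "wnorm2 J P r \<le> \<rho>\<^sup>2"
proof (rule ccontr)
  define h where "h = \<rho> / (40 * sqrt (real K))"
  have h: "0 < h" using \<rho> K by (simp add: h_def)
  have h2: "h\<^sup>2 * real K = (\<rho> / 40)\<^sup>2"
    using K by (simp add: h_def power_divide power_mult_distrib)
  have P0: "0 \<le> P j" if "j \<in> J" for j using P[OF that] by simp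
  assume "\<not> wnorm2 J P r \<le> \<rho>\<^sup>2"
  then have gt: "\<rho>\<^sup>2 < wnorm2 J P r" by simp
  define t where "t = \<rho> / sqrt (wnorm2 J P r)"
  have W: "0 < wnorm2 J P r" using gt zero_le_power2[of \<rho>] by linarith
  have t0: "0 < t" using \<rho> W by (simp add: t_def)
  have t1: "t \<le> 1"
    using gt \<rho> W by (simp add: t_def real_le_rsqrt)
  have "wnorm2 J P (lincomb K f (\<lambda>l. t * d l)) = t\<^sup>2 * wnorm2 J P r"
    unfolding wnorm2_def lincomb_scale using r by (simp add: sum_distrib_left power_mult_distrib mult_ac)
  also have "\<dots> = \<rho>\<^sup>2" using W by (simp add: t_def power_divide)
  finally have norm_t: "wnorm2 J P (lincomb K f (\<lambda>l. t * d l)) = \<rho>\<^sup>2" .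
  obtain d' where d': "\<And>j. j \<in> J \<Longrightarrow> lincomb K f d' j = lincomb K f (\<lambda>l. t * d l) j"
    and norm_d': "(\<Sum>l<K. (d' l)\<^sup>2) = \<rho>\<^sup>2"
    using orthonormal_coordinates[OF f, of "\<lambda>l. t * d l"] norm_t by metis
  let ?r' = "lincomb K f d'"
  have r': "?r' j = t * r j" if "j \<in> J" for j
    using d'[OF that] r[OF that] by (simp add: lincomb_scale)
  have r'_small: "\<bar>?r' j\<bar> \<le> 1 / 4" if j: "j \<in> J" for j
  proof -
    have "t * \<bar>r j\<bar> \<le> 1 * (1 / 4)" using t0 t1 r_small[OF j] by (intro mult_mono) auto
    then show ?thesis using t0 by (simp add: r'[OF j] abs_mult)
  qed
  have "0 \<le> excess J P X ?r'"
  proof -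
    have "0 \<le> (\<Sum>j\<in>J. X j * (t * r j - (t * r j)\<^sup>2 / 3))"
    proof (rule quadratic_lik_nonneg)
      show "- 1 < r j" if "j \<in> J" for j using r_small[OF that] by linarith
      show "\<bar>t * r j\<bar> \<le> 1 / 4" if "j \<in> J" for j using r'_small[OF that] r'[OF that] by simp
    qed (use X t0 t1 lik in auto)
    moreover have "t * (\<Sum>j\<in>J. P j * r j) \<le> 0" using drift t0 by (simp add: mult_le_0_iff)
    ultimately show ?thesis
      by (simp add: excess_def r' sum_distrib_left mult_ac)
  qed
  moreover have "\<exists>z::nat \<Rightarrow> int. (\<forall>l<K. \<bar>h * z l - d' l\<bar> \<le> h) \<and>
      excess J P X ?r' - h\<^sup>2 / 3 * (\<Sum>j\<in>J. X j * (\<Sum>l<K. (f l j)\<^sup>2))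
        \<le> excess J P X (lincomb K f (\<lambda>l. h * z l))"
    unfolding excess_def using X by (rule round_to_lattice[OF h])
  then obtain z' :: "nat \<Rightarrow> int" where z': "\<And>l. l < K \<Longrightarrow> \<bar>h * z' l - d' l\<bar> \<le> h"
    and Q: "excess J P X ?r' - h\<^sup>2 / 3 * (\<Sum>j\<in>J. X j * (\<Sum>l<K. (f l j)\<^sup>2))
        \<le> excess J P X (lincomb K f (\<lambda>l. h * z' l))"
    by blast
  moreover have "h\<^sup>2 / 3 * (\<Sum>j\<in>J. X j * (\<Sum>l<K. (f l j)\<^sup>2)) \<le> h\<^sup>2 / 3 * (3 * real K)"
    using leverage by (intro mult_left_mono) auto
  ultimately have not_below: "- (\<rho> / 40)\<^sup>2 \<le> excess J P X (lincomb K f (\<lambda>l. h * z' l))"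
    using h2 Q by simp
  define z where "z = restrict z' {..<K}"
  define w where "w l = h * z l" for l
  have w_d': "\<bar>w l - d' l\<bar> \<le> h" if "l < K" for l using z'[OF that] that by (simp add: w_def z_def)
  have lincomb_w: "lincomb K f (\<lambda>l. h * z' l) = lincomb K f w"
    by (auto simp: lincomb_def w_def z_def)
  have err: "wnorm2 J P (\<lambda>j. lincomb K f w j - ?r' j) \<le> (\<rho> / 40)\<^sup>2"
  proof -
    have "wnorm2 J P (lincomb K f (\<lambda>l. w l - d' l)) \<le> (\<Sum>l<K. (w l - d' l)\<^sup>2)"
      by (rule wnorm2_lincomb_orthonormal_le[OF f])
    also have "\<dots> \<le> (\<Sum>l<K. h\<^sup>2)"
      using w_d' h by (intro sum_mono) (auto simp: abs_le_square_iff[symmetric])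
    finally show ?thesis using h2 by (simp add: lincomb_diff[abs_def] mult.commute)
  qed
  have "z \<in> lattice_net J P K f h \<rho>"
    unfolding lattice_net_def
  proof (intro CollectI conjI)
    show "z \<in> PiE {..<K} (\<lambda>_. UNIV)" by (simp add: z_def)
    show "(\<Sum>l<K. \<bar>z l\<bar>) \<le> int (41 * K)"
    proof -
      have "(\<Sum>l<K. 1 * \<bar>d' l\<bar>)\<^sup>2 \<le> (\<Sum>l<K. 1\<^sup>2) * (\<Sum>l<K. \<bar>d' l\<bar>\<^sup>2)"
        by (rule Cauchy_Schwarz_ineq_sum)
      then have "(\<Sum>l<K. \<bar>d' l\<bar>)\<^sup>2 \<le> real K * \<rho>\<^sup>2" using norm_d' by simp
      also have "\<dots> = (40 * real K * h)\<^sup>2"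
      proof -
        have "\<rho>\<^sup>2 = 1600 * (h\<^sup>2 * real K)" using h2 by (simp add: power_divide)
        then have "real K * \<rho>\<^sup>2 = real K * (1600 * (h\<^sup>2 * real K))" by (simp only:)
        also have "\<dots> = (40 * real K * h)\<^sup>2" by (simp add: power2_eq_square)
        finally show ?thesis .
      qed
      finally have "(\<Sum>l<K. \<bar>d' l\<bar>) \<le> 40 * real K * h"
        by (rule power2_le_imp_le) (use h in simp)
      moreover have "(\<Sum>l<K. \<bar>w l\<bar>) \<le> (\<Sum>l<K. \<bar>d' l\<bar> + h)"
      proof (rule sum_mono)
        show "\<bar>w l\<bar> \<le> \<bar>d' l\<bar> + h" if "l \<in> {..<K}" for l
          using w_d'[of l] that by simp
      qed
      moreover have "(\<Sum>l<K. \<bar>d' l\<bar> + h) = (\<Sum>l<K. \<bar>d' l\<bar>) + real K * h"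
        by (simp add: sum.distrib)
      moreover have "40 * real K * h + real K * h = h * (41 * real K)"
        by (simp add: algebra_simps)
      moreover have "(\<Sum>l<K. \<bar>w l\<bar>) = h * real_of_int (\<Sum>l<K. \<bar>z l\<bar>)"
        using h by (simp add: w_def abs_mult sum_distrib_left)
      ultimately have "h * real_of_int (\<Sum>l<K. \<bar>z l\<bar>) \<le> h * (41 * real K)"
        by argo
      then have "real_of_int (\<Sum>l<K. \<bar>z l\<bar>) \<le> 41 * real K" using h by simp
      then have "real_of_int (\<Sum>l<K. \<bar>z l\<bar>) \<le> real_of_int (int (41 * K))" by simp
      then show ?thesis by (simp only: of_int_le_iff)
    qed
    show "(39 / 40 * \<rho>)\<^sup>2 \<le> wnorm2 J P (lincomb K f (\<lambda>l. h * z l))"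
    proof -
      let ?e = "\<lambda>j. ?r' j - lincomb K f w j"
      have r'2: "wnorm2 J P ?r' = \<rho>\<^sup>2"
        using norm_t d' by (simp add: wnorm2_def)
      have e2: "wnorm2 J P ?e \<le> (\<rho> / 40)\<^sup>2"
        using err by (simp add: wnorm2_def power2_commute)
      have "(\<Sum>j\<in>J. P j * (?r' j * ?e j))\<^sup>2 \<le> wnorm2 J P ?r' * wnorm2 J P ?e"
        using P0 by (rule weighted_cauchy_schwarz)
      also have "\<dots> \<le> \<rho>\<^sup>2 * (\<rho> / 40)\<^sup>2"
        using e2 r'2 by (simp add: mult_left_mono)
      also have "\<dots> = (\<rho>\<^sup>2 / 40)\<^sup>2" by (simp add: power2_eq_square)
      finally have "\<bar>\<Sum>j\<in>J. P j * (?r' j * ?e j)\<bar> \<le> \<rho>\<^sup>2 / 40"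
        by (metis abs_le_square_iff abs_of_nonneg divide_nonneg_pos zero_le_power2 zero_less_numeral)
      moreover have "(\<Sum>j\<in>J. P j * (?r' j * lincomb K f w j))
          = wnorm2 J P ?r' - (\<Sum>j\<in>J. P j * (?r' j * ?e j))"
        by (simp add: wnorm2_def sum_subtractf[symmetric] power2_eq_square algebra_simps)
      ultimately have inner: "39 / 40 * \<rho>\<^sup>2 \<le> (\<Sum>j\<in>J. P j * (?r' j * lincomb K f w j))"
        using r'2 by linarith
      have "(39 / 40 * \<rho>\<^sup>2)\<^sup>2 \<le> (\<Sum>j\<in>J. P j * (?r' j * lincomb K f w j))\<^sup>2"
        using inner by (intro power_mono) auto
      also have "\<dots> \<le> wnorm2 J P ?r' * wnorm2 J P (lincomb K f w)"
        using P0 by (rule weighted_cauchy_schwarz)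
      finally have "\<rho>\<^sup>2 * (39 / 40 * \<rho>)\<^sup>2 \<le> \<rho>\<^sup>2 * wnorm2 J P (lincomb K f w)"
        unfolding r'2 by (simp add: power2_eq_square mult_ac)
      then have "(39 / 40 * \<rho>)\<^sup>2 \<le> wnorm2 J P (lincomb K f w)"
        by (rule mult_left_le_imp_le) (use \<rho> in simp)
      then show ?thesis by (simp only: w_def[abs_def])
    qed
    show "(\<Sum>j\<in>J. P j * (if \<bar>lincomb K f (\<lambda>l. h * z l) j\<bar> > 1 / 2
        then (lincomb K f (\<lambda>l. h * z l) j)\<^sup>2 else 0)) \<le> 4 * (\<rho> / 40)\<^sup>2"
    proof -
      have "(\<Sum>j\<in>J. P j * (if \<bar>lincomb K f w j\<bar> > 1 / 2 then (lincomb K f w j)\<^sup>2 else 0))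
          \<le> (\<Sum>j\<in>J. P j * (4 * (lincomb K f w j - ?r' j)\<^sup>2))"
      proof (intro sum_mono mult_left_mono)
        fix j assume j: "j \<in> J"
        show "(if \<bar>lincomb K f w j\<bar> > 1 / 2 then (lincomb K f w j)\<^sup>2 else 0) \<le> 4 * (lincomb K f w j - ?r' j)\<^sup>2"
        \<comment> \<open>The unrounded value is at most 1/4, so at least half of a value above 1/2 is rounding error.\<close>
        proof (cases "\<bar>lincomb K f w j\<bar> > 1 / 2")
          case True
          then have "1 / 2 * \<bar>lincomb K f w j\<bar> \<le> \<bar>lincomb K f w j - ?r' j\<bar>"
            using r'_small[OF j] by linarith
          then have "\<bar>lincomb K f w j\<bar> \<le> \<bar>2 * (lincomb K f w j - ?r' j)\<bar>"
            unfolding abs_mult by simp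
          then have "(lincomb K f w j)\<^sup>2 \<le> (2 * (lincomb K f w j - ?r' j))\<^sup>2"
            by (simp only: abs_le_square_iff)
          then show ?thesis using True by (simp only: power_mult_distrib) simp
        qed simp
      qed (use P0 in auto)
      also have "\<dots> = 4 * wnorm2 J P (\<lambda>j. lincomb K f w j - ?r' j)"
        by (simp add: wnorm2_def sum_distrib_left mult_ac)
      also have "\<dots> \<le> 4 * (\<rho> / 40)\<^sup>2" using err by argo
      finally show ?thesis by (simp only: w_def[abs_def])
    qed
  qed
  from net[folded h_def, OF this] have "excess J P X (lincomb K f w) < - (\<rho> / 40)\<^sup>2"
    by (simp only: w_def[abs_def])
  then show False
    using not_below lincomb_w by simp
qed

section \<open>Restricted eigenvalues and the likelihood of the topic model\<close>

lemma norm1_nonneg [simp]: "0 \<le> norm1 I v"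
  by (simp add: norm1_def sum_nonneg)

lemma bdd_below_kappa_ratios:
  "bdd_below ((\<lambda>(S, v). norm1 U (mat_vec K A v) / norm1 {..<K} v) ` Z)"
  by (rule bdd_belowI[of _ 0]) auto

lemma kappa_mult_norm1_le:
  assumes "S \<subseteq> {..<K}" "card S \<le> s" "norm1 ({..<K} - S) v \<le> norm1 S v"
  shows "kappa K U A s * norm1 {..<K} v \<le> norm1 U (mat_vec K A v)"
proof (cases "\<exists>k<K. v k \<noteq> 0")
  case True
  then obtain k where k: "k < K" "v k \<noteq> 0" by auto
  have "\<bar>v k\<bar> \<le> norm1 {..<K} v"
    unfolding norm1_def using k by (intro member_le_sum) auto
  then have pos: "0 < norm1 {..<K} v" using k by simp
  have "(S, v) \<in> (SIGMA S:{S. S \<subseteq> {..<K} \<and> card S \<le> s}. cone K S)"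
    using assms True by (simp add: cone_def)
  then have "kappa K U A s \<le> norm1 U (mat_vec K A v) / norm1 {..<K} v"
    unfolding kappa_def by (intro cINF_lower2[OF bdd_below_kappa_ratios]) auto
  then show ?thesis using pos by (simp add: pos_le_divide_eq)
next
  case False
  then have "norm1 {..<K} v = 0" by (simp add: norm1_def)
  then show ?thesis by simp
qed

lemma unit_vec_in_cone:
  assumes "1 \<le> K" "1 \<le> s"
  shows "({0}, \<lambda>k. if k = 0 then 1 else 0) \<in> (SIGMA S:{S. S \<subseteq> {..<K} \<and> card S \<le> s}. cone K S)"
  using assms by (auto simp: cone_def norm1_def intro!: exI[of _ 0])

lemma kappa_le_1:
  assumes K: "1 \<le> K" "1 \<le> s" and U: "U \<subseteq> {..<p}" and A: "\<forall>k<K. (\<lambda>j. A j k) \<in> prob_simplex p"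
  shows "kappa K U A s \<le> 1"
proof -
  let ?e = "\<lambda>k::nat. if k = 0 then 1 else 0 :: real"
  have "kappa K U A s * norm1 {..<K} ?e \<le> norm1 U (mat_vec K A ?e)"
    using unit_vec_in_cone[OF K] by (intro kappa_mult_norm1_le[of "{0}"]) (auto simp: cone_def)
  moreover have "norm1 {..<K} ?e = 1"
  proof -
    have "norm1 {..<K} ?e = (\<Sum>k<K. if k = 0 then 1 else 0)"
      unfolding norm1_def by (intro sum.cong) auto
    then show ?thesis using K by simp
  qed
  moreover have "norm1 U (mat_vec K A ?e) \<le> 1"
  proof -
    have "mat_vec K A ?e j = A j 0" for j
    proof -
      have "mat_vec K A ?e j = (\<Sum>k<K. if k = 0 then A j 0 else 0)"
        unfolding mat_vec_def by (intro sum.cong) auto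
      then show ?thesis using K by simp
    qed
    then have "norm1 U (mat_vec K A ?e) = (\<Sum>j\<in>U. \<bar>A j 0\<bar>)" by (simp add: norm1_def)
    also have "\<dots> \<le> (\<Sum>j<p. \<bar>A j 0\<bar>)" using U by (intro sum_mono2) auto
    also have "\<dots> = (\<Sum>j<p. A j 0)"
      using A K by (intro sum.cong) (auto simp: prob_simplex_def)
    also have "\<dots> = 1" using A K by (auto simp: prob_simplex_def)
    finally show ?thesis .
  qed
  ultimately show ?thesis by simp
qed

lemma kappa_mono:
  assumes K: "1 \<le> K" "1 \<le> s" and U: "U \<subseteq> V" "finite V"
  shows "kappa K U A s \<le> kappa K V A s"
  unfolding kappa_def
proof (rule cINF_mono[OF _ bdd_below_kappa_ratios])
  show "(SIGMA S:{S. S \<subseteq> {..<K} \<and> card S \<le> s}. cone K S) \<noteq> {}"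
    using unit_vec_in_cone[OF K] by blast
  have "norm1 U w \<le> norm1 V w" for w
    unfolding norm1_def using U by (intro sum_mono2) auto
  then have le: "norm1 U (mat_vec K A v) / norm1 {..<K} v \<le> norm1 V (mat_vec K A v) / norm1 {..<K} v" for v
    by (intro divide_right_mono) auto
  show "\<exists>x\<in>(SIGMA S:{S. S \<subseteq> {..<K} \<and> card S \<le> s}. cone K S).
      (case x of (S, v) \<Rightarrow> norm1 U (mat_vec K A v) / norm1 {..<K} v)
      \<le> (case y of (S, v) \<Rightarrow> norm1 V (mat_vec K A v) / norm1 {..<K} v)"
    if "y \<in> (SIGMA S:{S. S \<subseteq> {..<K} \<and> card S \<le> s}. cone K S)" for y
    using that le by (intro bexI[of _ y]) (auto split: prod.split)
qed

text \<open>
  Both vectors have mass 1, and off the support of the first one the difference is nonnegative, so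
  mass gained there was lost on the support.
\<close>

lemma mle_error_in_cone:
  assumes T: "T \<in> prob_simplex K" and T': "T' \<in> prob_simplex K"
  shows "norm1 ({..<K} - supp K T) (\<lambda>k. T' k - T k) \<le> norm1 (supp K T) (\<lambda>k. T' k - T k)"
proof -
  let ?S = "supp K T"
  have S: "?S \<subseteq> {..<K}" by (auto simp: supp_def)
  have split: "(\<Sum>k<K. w k) = (\<Sum>k\<in>{..<K} - ?S. w k) + (\<Sum>k\<in>?S. w k)" for w :: "nat \<Rightarrow> real"
    using S by (intro sum.subset_diff) auto
  have "norm1 ({..<K} - ?S) (\<lambda>k. T' k - T k) = (\<Sum>k\<in>{..<K} - ?S. T' k - T k)"
    unfolding norm1_def using T' by (intro sum.cong) (auto simp: supp_def prob_simplex_def)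
  also have "\<dots> = - (\<Sum>k\<in>?S. T' k - T k)"
    using split[of "\<lambda>k. T' k - T k"] T T' by (simp add: prob_simplex_def sum_subtractf)
  also have "\<dots> \<le> \<bar>\<Sum>k\<in>?S. T' k - T k\<bar>" by simp
  also have "\<dots> \<le> norm1 ?S (\<lambda>k. T' k - T k)"
    unfolding norm1_def by (rule sum_abs)
  finally show ?thesis .
qed

lemma mat_vec_diff: "mat_vec K A (\<lambda>k. v k - w k) j = mat_vec K A v j - mat_vec K A w j"
  by (simp add: mat_vec_def algebra_simps sum_subtractf)

lemma mat_vec_eq_lincomb: "mat_vec K A v j = q j * lincomb K (\<lambda>k j. A j k / q j) v j" if "q j \<noteq> 0"
  using that by (simp add: mat_vec_def lincomb_def sum_distrib_left mult_ac)

lemma T_min_bounds: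
  assumes "T \<in> prob_simplex K"
  shows "0 < T_min K T" "k \<in> supp K T \<Longrightarrow> T_min K T \<le> T k" "T_min K T \<le> 1"
proof -
  have fin: "finite (supp K T)" by (simp add: supp_def)
  have ne: "supp K T \<noteq> {}"
  proof
    assume "supp K T = {}"
    then have "(\<Sum>k<K. T k) = 0" by (intro sum.neutral) (auto simp: supp_def)
    then show False using assms by (simp add: prob_simplex_def)
  qed
  have "T_min K T \<in> T ` supp K T" unfolding T_min_def using fin ne by (intro Min_in) auto
  then obtain k where k: "k \<in> supp K T" "T_min K T = T k" by auto
  then show "0 < T_min K T" using assms by (auto simp: supp_def prob_simplex_def order_le_less)
  have "T k \<le> (\<Sum>k<K. T k)"
    using k assms by (intro member_le_sum) (auto simp: supp_def prob_simplex_def)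
  then show "T_min K T \<le> 1" using k assms by (simp add: prob_simplex_def)
  show "T_min K T \<le> T k" if "k \<in> supp K T" for k
    unfolding T_min_def using fin that by (intro Min_le) auto
qed

text \<open>
  On the support of \<open>T\<close> an entry \<open>A\<^sub>j\<^sub>k\<close> contributes at least \<open>A\<^sub>j\<^sub>k T\<^sub>m\<^sub>i\<^sub>n\<close> to the probability of word \<open>j\<close>;
  off the support it is compared with the row sum over the support, at the price of \<^const>\<open>xi\<close>.
\<close>

lemma relative_column_bound:
  assumes A: "\<forall>k<K. (\<lambda>j. A j k) \<in> prob_simplex p" and T: "T \<in> prob_simplex K"
    and j: "j \<in> J_over p (mat_vec K A T)" and k: "k < K"
  shows "A j k / mat_vec K A T j \<le> max 1 (xi p K A T) / T_min K T" "0 \<le> xi p K A T"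
proof -
  let ?\<pi> = "mat_vec K A T" and ?S = "supp K T"
  have jp: "j < p" and pj: "0 < ?\<pi> j" using j by (auto simp: J_over_def)
  have A0: "0 \<le> A j k" if "k < K" "j < p" for j k
    using A that by (auto simp: prob_simplex_def)
  have T0: "0 \<le> T k" if "k < K" for k using T that by (auto simp: prob_simplex_def)
  note Tm = T_min_bounds[OF T]
  have pi_S: "?\<pi> j = (\<Sum>k\<in>?S. A j k * T k)" for j
    unfolding mat_vec_def by (intro sum.mono_neutral_right) (auto simp: supp_def)
  have row: "norm1 ?S (A j) * T_min K T \<le> ?\<pi> j"
  proof -
    have "norm1 ?S (A j) * T_min K T = (\<Sum>k\<in>?S. A j k * T_min K T)"
      unfolding norm1_def sum_distrib_right using A0 jp by (intro sum.cong) (auto simp: supp_def)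
    also have "\<dots> \<le> (\<Sum>k\<in>?S. A j k * T k)"
      using A0 jp Tm by (intro sum_mono mult_left_mono) (auto simp: supp_def)
    finally show ?thesis by (simp add: pi_S)
  qed
  have row_pos: "0 < norm1 ?S (A j)" if "j \<in> J_over p ?\<pi>" for j
  proof (rule ccontr)
    assume "\<not> 0 < norm1 ?S (A j)"
    then have "norm1 ?S (A j) = 0" using norm1_nonneg[of ?S "A j"] by linarith
    then have "\<forall>k\<in>?S. A j k = 0"
      by (subst (asm) norm1_def, subst (asm) sum_nonneg_eq_0_iff) (auto simp: supp_def)
    then have "?\<pi> j = 0" by (simp add: pi_S)
    then show False using that by (simp add: J_over_def)
  qed
  have xi_ge: "norm_inf ({..<K} - ?S) (A j) / norm1 ?S (A j) \<le> xi p K A T" if "?S \<noteq> {..<K}"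
    unfolding xi_def using that j by (auto intro!: Max_ge)
  have inf_ge: "\<bar>A j k\<bar> \<le> norm_inf ({..<K} - ?S) (A j)" if "k \<in> {..<K} - ?S" for k
    unfolding norm_inf_def using that by (intro Max_ge) auto
  show xi0: "0 \<le> xi p K A T"
  proof (cases "?S = {..<K}")
    case False
    then obtain i where i: "i \<in> {..<K} - ?S" by (auto simp: supp_def)
    have "0 \<le> norm_inf ({..<K} - ?S) (A j) / norm1 ?S (A j)"
      using inf_ge[OF i] by (intro divide_nonneg_nonneg) auto
    then show ?thesis using xi_ge[OF False] by linarith
  qed (simp add: xi_def)
  have "A j k * T_min K T \<le> max 1 (xi p K A T) * ?\<pi> j"
  proof (cases "k \<in> ?S")
    case True
    have "A j k * T_min K T \<le> norm1 ?S (A j) * T_min K T"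
    proof (rule mult_right_mono)
      have "\<bar>A j k\<bar> \<le> norm1 ?S (A j)"
        unfolding norm1_def using True by (intro member_le_sum) (auto simp: supp_def)
      then show "A j k \<le> norm1 ?S (A j)" by simp
    qed (use Tm in simp)
    also note row
    also have "?\<pi> j \<le> max 1 (xi p K A T) * ?\<pi> j"
      using mult_right_mono[of 1 "max 1 (xi p K A T)" "?\<pi> j"] pj by simp
    finally show ?thesis .
  next
    case False
    then have ne: "?S \<noteq> {..<K}" using k by auto
    have "A j k \<le> norm_inf ({..<K} - ?S) (A j)" using inf_ge[of k] False k by simp
    also have "\<dots> \<le> xi p K A T * norm1 ?S (A j)"
      using xi_ge[OF ne] row_pos[OF j] by (simp add: pos_divide_le_eq)
    finally have "A j k * T_min K T \<le> xi p K A T * norm1 ?S (A j) * T_min K T"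
      using Tm by (intro mult_right_mono) auto
    also have "\<dots> \<le> xi p K A T * ?\<pi> j"
      using row xi0 by (simp add: mult.assoc mult_left_mono)
    also have "\<dots> \<le> max 1 (xi p K A T) * ?\<pi> j"
      using pj by (intro mult_right_mono) auto
    finally show ?thesis .
  qed
  then show "A j k / ?\<pi> j \<le> max 1 (xi p K A T) / T_min K T"
    using Tm pj by (simp add: field_simps)
qed

text \<open>
  The likelihood at the truth is finite because every observed word has positive probability. So the
  likelihood at the maximiser is finite too, and real logarithms may replace extended ones.
\<close>

lemma mle_loglik_ratio_nonneg:
  assumes A: "\<forall>k<K. (\<lambda>j. A j k) \<in> prob_simplex p" and T: "T \<in> prob_simplex K"
    and X: "\<And>j. 0 \<le> X j" "\<And>j. j \<notin> J_over p (mat_vec K A T) \<Longrightarrow> X j = 0"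
    and mle: "is_mle p K A X T'"
  defines "q \<equiv> \<lambda>j. mat_vec K A T' j / mat_vec K A T j"
  shows "T' \<in> prob_simplex K" "0 < X j \<Longrightarrow> 0 < q j"
    "0 \<le> (\<Sum>j\<in>J_over p (mat_vec K A T). X j * ln (q j))"
proof -
  let ?\<pi> = "mat_vec K A T" and ?\<pi>' = "mat_vec K A T'"
  let ?J = "J_over p ?\<pi>"
  show T': "T' \<in> prob_simplex K" using mle by (simp add: is_mle_def is_arg_max_def)
  have le: "log_lik p K A X T \<le> log_lik p K A X T'"
    using mle T by (auto simp: is_mle_def is_arg_max_def)
  let ?I = "{j. j < p \<and> 0 < X j}"
  have I: "?I \<subseteq> ?J" using X(2) by force
  have pos: "0 < ?\<pi> j" if "0 < X j" for j using X(2)[of j] that by (force simp: J_over_def)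
  have ll_T: "log_lik p K A X T = ereal (\<Sum>j\<in>?I. X j * ln (?\<pi> j))"
    unfolding log_lik_def elog_def using pos by (subst sum_ereal[symmetric]) (intro sum.cong; simp)
  have pos': "0 < ?\<pi>' j" if j: "0 < X j" for j
  proof (rule ccontr)
    assume neg: "\<not> 0 < ?\<pi>' j"
    have jI: "j \<in> ?I" using I X(2)[of j] j by (force simp: J_over_def)
    have "log_lik p K A X T' = - \<infinity> + (\<Sum>i\<in>?I - {j}. ereal (X i) * elog (?\<pi>' i))"
      unfolding log_lik_def using jI neg j by (subst sum.remove[of _ j]) (simp_all add: elog_def)
    moreover have "(\<Sum>i\<in>?I - {j}. ereal (X i) * elog (?\<pi>' i)) \<noteq> \<infinity>"
      by (auto simp: sum_Pinfty elog_def)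
    ultimately have "log_lik p K A X T' = - \<infinity>" by simp
    then show False using le ll_T by simp
  qed
  then show "0 < X j \<Longrightarrow> 0 < q j" for j using pos by (simp add: q_def)
  have ll_T': "log_lik p K A X T' = ereal (\<Sum>j\<in>?I. X j * ln (?\<pi>' j))"
    unfolding log_lik_def elog_def using pos' by (subst sum_ereal[symmetric]) (intro sum.cong; simp)
  have "0 \<le> (\<Sum>j\<in>?I. X j * ln (?\<pi>' j)) - (\<Sum>j\<in>?I. X j * ln (?\<pi> j))"
    using le unfolding ll_T ll_T' by simp
  also have "\<dots> = (\<Sum>j\<in>?I. X j * ln (q j))"
    unfolding sum_subtractf[symmetric]
  proof (rule sum.cong)
    fix j assume "j \<in> ?I"
    then have "0 < ?\<pi> j" "0 < ?\<pi>' j" using pos pos' by auto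
    then show "X j * ln (?\<pi>' j) - X j * ln (?\<pi> j) = X j * ln (q j)"
      by (simp add: q_def ln_div right_diff_distrib)
  qed simp
  also have "\<dots> = (\<Sum>j\<in>?J. X j * ln (q j))"
    using I X(1) by (intro sum.mono_neutral_left) (auto simp: J_over_def order_le_less)
  finally show "0 \<le> (\<Sum>j\<in>?J. X j * ln (q j))" .
qed

section \<open>The maximum likelihood estimator\<close>

text \<open>
  The deterministic part of the argument: the error bound for all data outside the exceptional
  events.
\<close>

lemma mle_error_le:
  fixes A :: "nat \<Rightarrow> nat \<Rightarrow> real" and T T' X :: "nat \<Rightarrow> real" and p K N s :: nat
  defines "\<pi> \<equiv> mat_vec K A T"
  defines "J \<equiv> J_over p \<pi>" and "U \<equiv> J_under p N \<pi>"
  defines "g \<equiv> \<lambda>k j. A j k / \<pi> j" and "m \<equiv> max 1 (xi p K A T) / T_min K T"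
  defines "\<rho> \<equiv> 100 * sqrt (real K / real N)"
  assumes dims: "1 \<le> K" "1 < p" "1 \<le> N" "1 \<le> s"
    and A: "\<forall>k<K. (\<lambda>j. A j k) \<in> prob_simplex p" and T: "T \<in> prob_simplex K" "card (supp K T) \<le> s"
    and \<kappa>: "0 < kappa K U A s"
    and small: "24 * \<epsilon> * m < (kappa K U A s)\<^sup>2"
    and f: "orthonormal_upto J \<pi> K f" "\<And>v. \<exists>d. \<forall>j\<in>J. lincomb K g v j = lincomb K f d j"
    and X: "\<And>j. 0 \<le> X j" "\<And>j. j \<notin> J \<Longrightarrow> X j = 0"
    and frequent: "\<And>j. j \<in> U \<Longrightarrow> \<pi> j / 2 \<le> X j"
    and noise: "\<And>k. k < K \<Longrightarrow> \<bar>(\<Sum>j\<in>J. X j * g k j) - (\<Sum>j\<in>J. \<pi> j * g k j)\<bar> \<le> \<epsilon>"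
    and leverage: "(\<Sum>j\<in>J. X j * (\<Sum>l<K. (f l j)\<^sup>2)) \<le> 3 * real K"
    and net: "\<And>z. z \<in> lattice_net J \<pi> K f (\<rho> / (40 * sqrt (real K))) \<rho> \<Longrightarrow>
      excess J \<pi> X (lincomb K f (\<lambda>l. \<rho> / (40 * sqrt (real K)) * z l)) < - (\<rho> / 40)\<^sup>2"
    and mle: "is_mle p K A X T'"
  shows "norm1 {..<K} (\<lambda>k. T' k - T k) \<le> 100 * inverse (kappa K J A s) * sqrt (real K / real N)"
proof -
  define v where "v k = T' k - T k" for k
  define r where "r = lincomb K g v"
  have finJ: "finite J" by (simp add: J_def)
  have \<pi>_simplex: "\<pi> \<in> prob_simplex p" unfolding \<pi>_def using A T by (intro mat_vec_prob_simplex) auto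
  have \<pi>_pos: "0 < \<pi> j" if "j \<in> J" for j using that by (simp add: J_def J_over_def)
  have sum_\<pi>: "sum \<pi> J = 1" unfolding J_def using \<pi>_simplex by (rule sum_J_over)
  have UJ: "U \<subseteq> J"
  proof
    fix j assume j: "j \<in> U"
    have "0 \<le> \<pi> j" using j \<pi>_simplex by (auto simp: U_def J_under_def prob_simplex_def)
    then have "0 \<le> eps p N \<pi> j" using dims by (auto simp: eps_def)
    then show "j \<in> J" using j by (auto simp: U_def J_def J_under_def J_over_def)
  qed
  note mle_facts = A T(1) X[unfolded J_def \<pi>_def] mle
  have lik: "T' \<in> prob_simplex K" "0 \<le> (\<Sum>j\<in>J. X j * ln (mat_vec K A T' j / \<pi> j))"
    unfolding J_def \<pi>_def
     apply (rule mle_loglik_ratio_nonneg(1); fact mle_facts)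
    apply (rule mle_loglik_ratio_nonneg(3); fact mle_facts)
    done
  have ratio_pos: "0 < mat_vec K A T' j / \<pi> j" if "0 < X j" for j
    unfolding \<pi>_def using mle_facts that by (rule mle_loglik_ratio_nonneg(2))
  have mv: "mat_vec K A w j = \<pi> j * lincomb K g w j" if "j \<in> J" for w j
    unfolding g_def using \<pi>_pos[OF that] by (intro mat_vec_eq_lincomb) auto
  have norm1_mv: "norm1 V (mat_vec K A w) = (\<Sum>j\<in>V. \<pi> j * \<bar>lincomb K g w j\<bar>)" if "V \<subseteq> J" for V w
    unfolding norm1_def using that mv \<pi>_pos
    by (intro sum.cong refl) (auto simp: abs_mult subset_iff less_imp_le abs_of_nonneg)
  have mv_v: "mat_vec K A v j = mat_vec K A T' j - \<pi> j" for j
    unfolding v_def \<pi>_def by (rule mat_vec_diff)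
  have ratio: "mat_vec K A T' j / \<pi> j = 1 + r j" if "j \<in> J" for j
    using mv_v[of j] mv[OF that, of v] \<pi>_pos[OF that] by (simp add: r_def field_simps)
  have T'_simplex: "mat_vec K A T' \<in> prob_simplex p"
    using A lik(1) by (intro mat_vec_prob_simplex) auto
  have drift: "(\<Sum>j\<in>J. \<pi> j * r j) \<le> 0"
  proof -
    have "(\<Sum>j\<in>J. \<pi> j * r j) = (\<Sum>j\<in>J. mat_vec K A T' j - \<pi> j)"
      by (intro sum.cong) (simp_all add: r_def mv[symmetric] mv_v)
    also have "\<dots> = (\<Sum>j\<in>J. mat_vec K A T' j) - 1"
      by (simp add: sum_subtractf sum_\<pi>)
    also have "(\<Sum>j\<in>J. mat_vec K A T' j) \<le> (\<Sum>j<p. mat_vec K A T' j)"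
      using T'_simplex by (intro sum_mono2) (auto simp: J_def J_over_def prob_simplex_def)
    also have "\<dots> = 1" using T'_simplex by (simp add: prob_simplex_def)
    finally show ?thesis by simp
  qed
  have pos: "- 1 < r j" if "j \<in> J" "0 < X j" for j
    using ratio_pos[OF that(2)] ratio[OF that(1)] by simp
  have lik0: "0 \<le> (\<Sum>j\<in>J. X j * ln (1 + r j))"
    using lik(2) ratio by simp
  have m: "0 < m" using T_min_bounds[OF T(1)] by (auto simp: m_def intro!: divide_pos_pos)
  have g: "\<bar>g k j\<bar> \<le> m" if "j \<in> J" "k < K" for j k
  proof -
    have "0 \<le> g k j" using A that \<pi>_pos[OF that(1)]
      by (auto simp: g_def J_def J_over_def prob_simplex_def)
    then show ?thesis
      using relative_column_bound(1)[OF A T(1), of j k] that by (simp add: g_def m_def J_def \<pi>_def)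
  qed
  have S: "supp K T \<subseteq> {..<K}" by (auto simp: supp_def)
  have cone: "norm1 ({..<K} - supp K T) v \<le> norm1 (supp K T) v"
    unfolding v_def using T(1) lik(1) by (rule mle_error_in_cone)
  have "norm1 {..<K} v \<le> 1 / (4 * m)"
  proof (rule crude_rate[where J = J and P = \<pi> and U = U and g = g and X = X and \<epsilon> = \<epsilon>])
    show "kappa K U A s * norm1 {..<K} v \<le> (\<Sum>j\<in>U. \<pi> j * \<bar>lincomb K g v j\<bar>)"
      using kappa_mult_norm1_le[OF S T(2) cone, of U A] norm1_mv[OF UJ, of v] by simp
    show "0 \<le> kappa K U A s" using \<kappa> by simp
    show "(\<Sum>j\<in>J. \<pi> j * lincomb K g v j) \<le> 0" using drift by (simp add: r_def)
    show "- 1 < lincomb K g v j" if "j \<in> J" "0 < X j" for j using pos[OF that] by (simp add: r_def)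
    show "0 \<le> (\<Sum>j\<in>J. X j * ln (1 + lincomb K g v j))" using lik0 by (simp add: r_def)
  qed (use finJ \<pi>_pos sum_\<pi> X(1) UJ frequent g m noise small in auto)
  then have r_small: "\<bar>r j\<bar> \<le> 1 / 4" if "j \<in> J" for j
  proof -
    assume le: "norm1 {..<K} v \<le> 1 / (4 * m)"
    have "\<bar>r j\<bar> \<le> m * norm1 {..<K} v" unfolding r_def using g[OF that] by (rule abs_lincomb_le)
    also have "\<dots> \<le> m * (1 / (4 * m))" using le m by (intro mult_left_mono) auto
    finally show ?thesis using m by simp
  qed
  obtain d where d: "\<And>j. j \<in> J \<Longrightarrow> r j = lincomb K f d j" using f(2) unfolding r_def by blast
  have \<rho>: "0 < \<rho>" using dims by (simp add: \<rho>_def)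
  have "wnorm2 J \<pi> r \<le> \<rho>\<^sup>2"
    using finJ \<pi>_pos X(1) f(1) dims(1) \<rho> leverage net d r_small drift lik0 by (rule fine_rate)
  then have "(\<Sum>j\<in>J. \<pi> j * \<bar>r j\<bar>)\<^sup>2 \<le> \<rho>\<^sup>2"
    using weighted_l1_le_l2[of J \<pi> r] \<pi>_pos sum_\<pi> by (force intro: order_trans less_imp_le)
  then have "(\<Sum>j\<in>J. \<pi> j * \<bar>r j\<bar>) \<le> \<rho>" by (rule power2_le_imp_le) (use \<rho> in simp)
  then have "kappa K J A s * norm1 {..<K} v \<le> \<rho>"
    using kappa_mult_norm1_le[OF S T(2) cone, of J A] norm1_mv[of J v] by (simp add: r_def)
  moreover have "0 < kappa K J A s"
    using \<kappa> kappa_mono[OF dims(1) dims(4) UJ finJ, of A] by linarith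
  ultimately show ?thesis
    by (simp add: v_def[abs_def] \<rho>_def pos_le_divide_eq field_simps)
qed

text \<open>
  Assembles the exceptional events. The lower bound on \<open>N\<close> through \<^const>\<open>M1\<close> serves the noise level in
  \<open>crude_rate\<close>; the one through \<^const>\<open>M2\<close> serves the leverages, which are at most
  \<open>(m / \<kappa>)\<^sup>2\<close> with \<open>\<kappa>\<close> the constant of the full cone, so that their empirical mean concentrates.
\<close>

lemma prob_mle_error_ge:
  fixes A :: "nat \<Rightarrow> nat \<Rightarrow> real" and T :: "nat \<Rightarrow> real" and p K N s :: nat
  assumes dims: "3 \<le> K" "K < p" "1 \<le> N" "1 \<le> s" "s \<le> K"
    and A: "\<forall>k<K. (\<lambda>j. A j k) \<in> prob_simplex p" and T: "T \<in> sparse_simplex K s"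
    and \<kappa>: "0 < kappa K (J_under p N (mat_vec K A T)) A s" "0 < kappa K (J_over p (mat_vec K A T)) A K"
    and N1: "6000 * M1 p K N A T s \<le> real N" and N2: "6000 * M2 p K A T s \<le> real N"
  shows "1 - 1 / real p - 2 / real K - 2 * exp (- real K) \<le>
    measure_pmf.prob (frequency_pmf p N (mat_vec K A T))
      {X. \<forall>T'. is_mle p K A X T' \<longrightarrow> norm1 {..<K} (\<lambda>k. T' k - T k)
        \<le> 100 * inverse (kappa K (J_over p (mat_vec K A T)) A s) * sqrt (real K / real N)}"
proof -
  define \<pi> where "\<pi> = mat_vec K A T"
  define J where "J = J_over p \<pi>"
  define U where "U = J_under p N \<pi>"
  define g where "g = (\<lambda>k j. A j k / \<pi> j)"
  define m where "m = max 1 (xi p K A T) / T_min K T"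
  define L where "L = ln (real K)"
  define \<epsilon> where "\<epsilon> = 3 * sqrt (m * L / real N)"
  define \<rho> where "\<rho> = 100 * sqrt (real K / real N)"
  define B where "B = (m / kappa K J A K)\<^sup>2"
  let ?\<kappa> = "kappa K U A s"
  let ?M = "frequency_pmf p N \<pi>"
  have T_simplex: "T \<in> prob_simplex K" and card_supp: "card (supp K T) = s"
    using T by (auto simp: sparse_simplex_def)
  have K1: "1 \<le> K" and p1: "1 < p" using dims by auto
  have \<pi>_simplex: "\<pi> \<in> prob_simplex p" unfolding \<pi>_def using A T_simplex by (intro mat_vec_prob_simplex) auto
  have finJ: "finite J" by (simp add: J_def)
  have \<pi>_pos: "0 < \<pi> j" if "j \<in> J" for j using that by (simp add: J_def J_over_def)
  have L1: "1 \<le> L"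
  proof -
    have "exp 1 \<le> (3::real)" by (rule exp_le)
    also have "\<dots> \<le> real K" using dims by simp
    finally show ?thesis unfolding L_def using K1 by (subst ln_ge_iff) auto
  qed
  note Tm = T_min_bounds[OF T_simplex]
  have m1: "1 \<le> m" using Tm by (simp add: m_def pos_le_divide_eq)
  have \<kappa>0: "0 < ?\<kappa>" "0 < kappa K J A K" using \<kappa> by (simp_all add: U_def J_def \<pi>_def)
  have \<kappa>1: "?\<kappa> \<le> 1"
    using K1 dims(4) A by (intro kappa_le_1[where p = p]) (auto simp: U_def J_under_def)
  have g: "0 \<le> g k j" "g k j \<le> m" if "j \<in> J" "k < K" for j k
  proof -
    show "0 \<le> g k j" using A that \<pi>_pos[OF that(1)]
      by (auto simp: g_def J_def J_over_def prob_simplex_def)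
    show "g k j \<le> m"
      using relative_column_bound(1)[OF A T_simplex, of j k] that by (simp add: g_def m_def J_def \<pi>_def)
  qed
  have xi0: "0 \<le> xi p K A T"
  proof -
    have "J \<noteq> {}" using sum_J_over[OF \<pi>_simplex] by (auto simp: J_def)
    then show ?thesis using relative_column_bound(2)[OF A T_simplex] K1 by (force simp: J_def \<pi>_def)
  qed
  have N1': "6000 * (m ^ 3 * L) \<le> real N * ?\<kappa> ^ 4"
  proof -
    have "max 1 (xi p K A T ^ 3) = max 1 (xi p K A T) ^ 3"
    proof (cases "1 \<le> xi p K A T")
      case True
      then show ?thesis using one_le_power[OF True, of 3] by (simp add: max_def)
    next
      case False
      then have "xi p K A T ^ 3 \<le> 1" using xi0 by (intro power_le_one) auto
      then show ?thesis using False by (simp add: max_def)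
    qed
    then have "M1 p K N A T s = m ^ 3 * L / ?\<kappa> ^ 4"
      using Tm by (simp add: M1_def m_def L_def U_def \<pi>_def power_divide mult.commute)
    then show ?thesis using N1 \<kappa>0 by (simp add: pos_divide_le_eq)
  qed
  have mL: "m * L \<le> real N"
  proof -
    have "m * L \<le> m ^ 3 * L" using m1 L1 by (intro mult_right_mono self_le_power) auto
    also have "\<dots> \<le> 6000 * (m ^ 3 * L)" using m1 L1 by simp
    also have "\<dots> \<le> real N * ?\<kappa> ^ 4" by (rule N1')
    also have "\<dots> \<le> real N * 1" using \<kappa>0 \<kappa>1 by (intro mult_left_mono power_le_one) auto
    finally show ?thesis by simp
  qed
  have small: "24 * \<epsilon> * m < ?\<kappa>\<^sup>2"
  proof (rule power2_less_imp_less)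
    have "(24 * \<epsilon> * m)\<^sup>2 = 5184 * (m * L / real N) * m\<^sup>2"
      using m1 L1 by (simp add: \<epsilon>_def power_mult_distrib)
    also have "\<dots> = 5184 * (m ^ 3 * L) / real N" by (simp add: power2_eq_square power3_eq_cube)
    also have "\<dots> < 6000 * (m ^ 3 * L) / real N"
      using m1 L1 dims(3) by (intro divide_strict_right_mono mult_strict_right_mono mult_pos_pos) auto
    also have "\<dots> \<le> ?\<kappa> ^ 4" using N1' dims(3) by (simp add: pos_divide_le_eq mult.commute)
    also have "\<dots> = (?\<kappa>\<^sup>2)\<^sup>2" by simp
    finally show "(24 * \<epsilon> * m)\<^sup>2 < (?\<kappa>\<^sup>2)\<^sup>2" .
  qed simp
  have B_N: "B \<le> real N" and B0: "0 < B"
  proof -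
    show "0 < B" using m1 \<kappa>0 by (simp add: B_def)
    have "max 1 (xi p K A T) \<le> 1 + xi p K A T * sqrt (real K - real s)"
    proof (cases "supp K T = {..<K}")
      case True
      then show ?thesis by (simp add: xi_def)
    next
      case False
      have "card (supp K T) < card {..<K}" using False by (intro psubset_card_mono) (auto simp: supp_def)
      then have "1 \<le> sqrt (real K - real s)" using card_supp by simp
      then have "xi p K A T * 1 \<le> xi p K A T * sqrt (real K - real s)"
        using xi0 by (intro mult_left_mono) auto
      then show ?thesis using xi0 by (simp add: max_def)
    qed
    then have "max 1 (xi p K A T) * max 1 (xi p K A T)
        \<le> max 1 (xi p K A T) * (1 + xi p K A T * sqrt (real K - real s))"
      by (intro mult_left_mono) auto
    moreover have "0 \<le> L / (kappa K J A K ^ 2 * T_min K T ^ 2)" using L1 by simp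
    ultimately have "L / (kappa K J A K ^ 2 * T_min K T ^ 2) * (max 1 (xi p K A T) * max 1 (xi p K A T)) \<le> M2 p K A T s"
      unfolding M2_def L_def J_def \<pi>_def mult.assoc[of "_ / _"] by (rule mult_left_mono)
    moreover have "L / (kappa K J A K ^ 2 * T_min K T ^ 2) * (max 1 (xi p K A T) * max 1 (xi p K A T)) = L * B"
      by (simp add: B_def m_def power_divide power2_eq_square)
    ultimately have "L * B \<le> M2 p K A T s" by simp
    moreover have "1 * B \<le> L * B" using L1 \<open>0 < B\<close> by (intro mult_right_mono) auto
    ultimately show "B \<le> real N" using N2 \<open>0 < B\<close> by linarith
  qed
  obtain f where f: "orthonormal_upto J \<pi> K f"
    and f_g: "\<And>l. l < K \<Longrightarrow> \<exists>c. \<forall>j\<in>J. f l j = lincomb K g c j"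
    and g_f: "\<And>v. \<exists>d. \<forall>j\<in>J. lincomb K g v j = lincomb K f d j"
    using gram_schmidt[of J \<pi> K g] finJ \<pi>_pos by blast
  have sup_norm: "(lincomb K f c j)\<^sup>2 \<le> B * wnorm2 J \<pi> (lincomb K f c)" if j: "j \<in> J" for c j
  proof -
    obtain w where w: "\<And>j. j \<in> J \<Longrightarrow> lincomb K f c j = lincomb K g w j"
      using lincomb_compose[of K J f K g c] f_g by blast
    have "\<bar>lincomb K g w j\<bar> \<le> m * norm1 {..<K} w"
      using g[OF j] by (intro abs_lincomb_le) auto
    moreover have "kappa K J A K * norm1 {..<K} w \<le> norm1 J (mat_vec K A w)"
      by (rule kappa_mult_norm1_le[of "{..<K}"]) (auto simp: norm1_def)
    moreover have "norm1 J (mat_vec K A w) = (\<Sum>j\<in>J. \<pi> j * \<bar>lincomb K g w j\<bar>)"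
      unfolding norm1_def
    proof (rule sum.cong)
      fix j assume "j \<in> J"
      then have "0 < \<pi> j" by (rule \<pi>_pos)
      then show "\<bar>mat_vec K A w j\<bar> = \<pi> j * \<bar>lincomb K g w j\<bar>"
        unfolding g_def by (subst mat_vec_eq_lincomb[of \<pi> j]) (auto simp: abs_mult)
    qed simp
    ultimately have "\<bar>lincomb K g w j\<bar> \<le> m / kappa K J A K * (\<Sum>j\<in>J. \<pi> j * \<bar>lincomb K g w j\<bar>)"
      using m1 \<kappa>0 by (smt (verit) mult_left_mono pos_le_divide_eq times_divide_eq_left mult.commute)
    then have "\<bar>lincomb K g w j\<bar>\<^sup>2 \<le> (m / kappa K J A K * (\<Sum>j\<in>J. \<pi> j * \<bar>lincomb K g w j\<bar>))\<^sup>2"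
      by (intro power_mono) auto
    also have "\<dots> = B * (\<Sum>j\<in>J. \<pi> j * \<bar>lincomb K g w j\<bar>)\<^sup>2" by (simp only: B_def power_mult_distrib)
    also have "\<dots> \<le> B * wnorm2 J \<pi> (lincomb K g w)"
      using B0 \<pi>_pos sum_J_over[OF \<pi>_simplex]
      by (intro mult_left_mono weighted_l1_le_l2) (auto simp: J_def less_imp_le)
    also have "wnorm2 J \<pi> (lincomb K g w) = wnorm2 J \<pi> (lincomb K f c)" using w by (simp add: wnorm2_def)
    finally show ?thesis using w[OF j] by simp
  qed

  let ?b = "\<lambda>j. \<Sum>l<K. (f l j)\<^sup>2"
  let ?dev = "\<lambda>k X. (\<Sum>j\<in>J. X j * g k j) - (\<Sum>j\<in>J. \<pi> j * g k j)"
  let ?h = "\<rho> / (40 * sqrt (real K))"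
  let ?E1 = "{X. \<exists>j\<in>U. X j \<le> \<pi> j / 2}"
  let ?E2 = "{X. \<exists>k\<in>{..<K}. \<epsilon> \<le> ?dev k X}"
  let ?E3 = "{X. \<exists>k\<in>{..<K}. \<epsilon> \<le> - ?dev k X}"
  let ?E4 = "{X. 3 * real K \<le> (\<Sum>j\<in>J. X j * ?b j)}"
  let ?E5 = "{X. \<exists>z\<in>lattice_net J \<pi> K f ?h \<rho>. - (\<rho> / 40)\<^sup>2 \<le> excess J \<pi> X (lincomb K f (\<lambda>l. ?h * z l))}"
  let ?good = "{X. \<forall>T'. is_mle p K A X T' \<longrightarrow> norm1 {..<K} (\<lambda>k. T' k - T k)
        \<le> 100 * inverse (kappa K J A s) * sqrt (real K / real N)}"

  have p1_E1: "measure_pmf.prob ?M ?E1 \<le> 1 / real p"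
    unfolding U_def using \<pi>_simplex dims(3) p1 by (rule prob_frequent_word_halved_le)
  have var: "wnorm2 J \<pi> (g k) \<le> m" if k: "k < K" for k
  proof -
    have "wnorm2 J \<pi> (g k) \<le> (\<Sum>j\<in>J. m * A j k)"
      unfolding wnorm2_def
    proof (rule sum_mono)
      fix j assume j: "j \<in> J"
      have "\<pi> j * (g k j)\<^sup>2 = A j k * g k j"
        using \<pi>_pos[OF j] by (simp add: g_def power2_eq_square)
      also have "\<dots> \<le> A j k * m"
        using g[OF j k] A k j by (intro mult_left_mono) (auto simp: prob_simplex_def J_def J_over_def)
      finally show "\<pi> j * (g k j)\<^sup>2 \<le> m * A j k" by (simp add: mult.commute)
    qed
    also have "\<dots> \<le> (\<Sum>j<p. m * A j k)"
      using A k m1 by (intro sum_mono2) (auto simp: J_def J_over_def prob_simplex_def)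
    also have "\<dots> = m * (\<Sum>j<p. A j k)" by (simp add: sum_distrib_left)
    also have "(\<Sum>j<p. A j k) = 1" using A k by (auto simp: prob_simplex_def)
    finally show ?thesis by simp
  qed
  have exp_L: "exp (- 2 * L) = 1 / (real K)\<^sup>2"
  proof -
    have "exp (- 2 * L) = inverse (exp L ^ 2)" by (simp add: exp_minus exp_double)
    then show ?thesis using K1 by (simp add: L_def inverse_eq_divide)
  qed
  have noise: "measure_pmf.prob ?M {X. \<epsilon> \<le> (\<Sum>j\<in>J. X j * (\<sigma> * g k j)) - (\<Sum>j\<in>J. \<pi> j * (\<sigma> * g k j))}
      \<le> 1 / (real K)\<^sup>2" if k: "k < K" and \<sigma>: "\<bar>\<sigma>\<bar> = 1" for k and \<sigma> :: real
    unfolding exp_L[symmetric] \<epsilon>_def J_def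
  proof (rule prob_bernstein_le[OF \<pi>_simplex dims(3)])
    show "\<bar>\<sigma> * g k j\<bar> \<le> m" if "j \<in> J_over p \<pi>" for j
      using g[of j k] k \<sigma> that by (simp add: abs_mult J_def)
    have "\<sigma>\<^sup>2 = 1" using \<sigma> by (metis power2_abs one_power2)
    then show "wnorm2 (J_over p \<pi>) \<pi> (\<lambda>j. \<sigma> * g k j) \<le> m"
      using var[OF k] by (simp add: wnorm2_def J_def power_mult_distrib)
  qed (use L1 m1 mL in auto)
  have KK: "real (card {..<K}) * (1 / (real K)\<^sup>2) = 1 / real K" by (simp add: power2_eq_square)
  have p1_E2: "measure_pmf.prob ?M ?E2 \<le> 1 / real K"
    unfolding KK[symmetric] using noise[of _ 1] by (intro prob_Bex_le) auto
  have p1_E3: "measure_pmf.prob ?M ?E3 \<le> 1 / real K"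
    unfolding KK[symmetric] using noise[of _ "-1"] by (intro prob_Bex_le) (auto simp: sum_negf)
  have p1_E4: "measure_pmf.prob ?M ?E4 \<le> exp (- real K)"
  proof -
    have "measure_pmf.prob ?M ?E4 \<le> exp (- real N * real K / B)"
      unfolding J_def
    proof (rule prob_nonneg_mean_large_le[OF \<pi>_simplex dims(3)])
      show "0 \<le> ?b j \<and> ?b j \<le> B" if "j \<in> J_over p \<pi>" for j
      proof
        show "0 \<le> ?b j" by (simp add: sum_nonneg)
        show "?b j \<le> B"
          using finJ \<pi>_pos f sup_norm that[folded J_def] less_imp_le[OF B0]
          by (rule orthonormal_leverage_le)
      qed
      show "(\<Sum>j\<in>J_over p \<pi>. \<pi> j * ?b j) \<le> real K"
        using orthonormal_leverage_mean[OF f] by (simp add: J_def)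
    qed (use B0 in auto)
    also have "\<dots> \<le> exp (- real K)"
    proof -
      have "real K * B \<le> real K * real N" using B_N by (intro mult_left_mono) auto
      then show ?thesis using B0 by (simp add: pos_le_divide_eq mult.commute)
    qed
    finally show ?thesis .
  qed
  have p1_E5: "measure_pmf.prob ?M ?E5 \<le> exp (- real K)"
    unfolding J_def
  proof (rule prob_lattice_excess_le[OF \<pi>_simplex dims(3) K1])
    show "10000 * real K \<le> real N * \<rho>\<^sup>2"
      using dims(3) by (simp add: \<rho>_def power_mult_distrib)
  qed
  have cover: "set_pmf ?M - ?good \<subseteq> ?E1 \<union> ?E2 \<union> ?E3 \<union> ?E4 \<union> ?E5"
  proof (rule subsetI, rule ccontr)
    fix X assume X: "X \<in> set_pmf ?M - ?good" and ok: "X \<notin> ?E1 \<union> ?E2 \<union> ?E3 \<union> ?E4 \<union> ?E5"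
    note supp = frequency_pmf_support[OF \<pi>_simplex, of X N]
    have "X \<in> ?good"
    proof (rule CollectI, intro allI impI)
      fix T' assume mle: "is_mle p K A X T'"
      show "norm1 {..<K} (\<lambda>k. T' k - T k) \<le> 100 * inverse (kappa K J A s) * sqrt (real K / real N)"
      proof (rule mle_error_le[where \<epsilon> = \<epsilon> and f = f and X = X and N = N, OF K1 p1 dims(3,4) A T_simplex,
            folded \<pi>_def, folded J_def U_def m_def g_def \<rho>_def])
        show "card (supp K T) \<le> s" using card_supp by simp
        show "0 \<le> X j" for j using X supp by auto
        show "X j = 0" if "j \<notin> J" for j using X supp that by (auto simp: J_def)
        show "\<pi> j / 2 \<le> X j" if "j \<in> U" for j using ok that by force
        show "\<bar>(\<Sum>j\<in>J. X j * (A j k / \<pi> j)) - (\<Sum>j\<in>J. \<pi> j * (A j k / \<pi> j))\<bar> \<le> \<epsilon>"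
          if "k < K" for k
        proof -
          have "\<not> \<epsilon> \<le> ?dev k X" "\<not> \<epsilon> \<le> - ?dev k X" using ok that by blast+
          then have "\<bar>?dev k X\<bar> \<le> \<epsilon>" by linarith
          then show ?thesis unfolding g_def .
        qed
        show "(\<Sum>j\<in>J. X j * ?b j) \<le> 3 * real K" using ok by simp
        show "excess J \<pi> X (lincomb K f (\<lambda>l. ?h * z l)) < - (\<rho> / 40)\<^sup>2"
          if "z \<in> lattice_net J \<pi> K f ?h \<rho>" for z
        proof -
          have "\<not> - (\<rho> / 40)\<^sup>2 \<le> excess J \<pi> X (lincomb K f (\<lambda>l. ?h * z l))" using ok that by blast
          then show ?thesis by linarith
        qed
      qed (use \<kappa>0 small f g_f mle in auto)
    qed
    then show False using X by simp
  qed
  have Un: "measure_pmf.prob ?M (E \<union> F) \<le> measure_pmf.prob ?M E + measure_pmf.prob ?M F" for E F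
    by (rule measure_Un_le) auto
  have "1 - measure_pmf.prob ?M ?good = measure_pmf.prob ?M (- ?good)"
    using measure_pmf.prob_compl[of ?good ?M] by (simp add: Compl_eq_Diff_UNIV)
  also have "\<dots> = measure_pmf.prob ?M (- ?good \<inter> set_pmf ?M)" by (simp add: measure_Int_set_pmf)
  also have "\<dots> \<le> measure_pmf.prob ?M (?E1 \<union> ?E2 \<union> ?E3 \<union> ?E4 \<union> ?E5)"
    using cover by (intro measure_pmf.finite_measure_mono) auto
  also have "\<dots> \<le> measure_pmf.prob ?M ?E1 + measure_pmf.prob ?M ?E2 + measure_pmf.prob ?M ?E3
      + measure_pmf.prob ?M ?E4 + measure_pmf.prob ?M ?E5"
    by (intro order_trans[OF Un add_right_mono] order_refl Un)
  also have "\<dots> \<le> 1 / real p + 1 / real K + 1 / real K + exp (- real K) + exp (- real K)"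
    by (intro add_mono p1_E1 p1_E2 p1_E3 p1_E4 p1_E5)
  finally show ?thesis by (simp add: J_def \<pi>_def)
qed

theorem theorem2:
  shows "\<exists>C C1 :: real. C > 0 \<and> C1 > 0 \<and>
    (\<forall>(p::nat) (K::nat) (N::nat) (s::nat) (A :: nat \<Rightarrow> nat \<Rightarrow> real) (T :: nat \<Rightarrow> real).
       1 \<le> K \<and> K < p \<and> 1 \<le> N \<and>
       (\<forall>k<K. (\<lambda>j. A j k) \<in> prob_simplex p) \<and>
       1 \<le> s \<and> s \<le> K \<and> T \<in> sparse_simplex K s \<and>
       kappa K (J_under p N (mat_vec K A T)) A s > 0 \<and>
       kappa K (J_over p (mat_vec K A T)) A K > 0 \<and>
       real N \<ge> C * max (M1 p K N A T s) (M2 p K A T s)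
       \<longrightarrow>
       measure_pmf.prob (frequency_pmf p N (mat_vec K A T))
         {X. \<forall>T_mle. is_mle p K A X T_mle \<longrightarrow>
               norm1 {..<K} (\<lambda>k. T_mle k - T k)
                 \<le> C1 * inverse (kappa K (J_over p (mat_vec K A T)) A s) * sqrt (real K / real N)}
       \<ge> 1 - 2 / real p - 4 / real K - 2 * exp (- real K))"
proof (rule exI[of _ 6000], rule exI[of _ 100], intro conjI allI impI)
  fix p K N s :: nat and A :: "nat \<Rightarrow> nat \<Rightarrow> real" and T :: "nat \<Rightarrow> real"
  let ?P = "measure_pmf.prob (frequency_pmf p N (mat_vec K A T))
         {X. \<forall>T_mle. is_mle p K A X T_mle \<longrightarrow>
               norm1 {..<K} (\<lambda>k. T_mle k - T k)
                 \<le> 100 * inverse (kappa K (J_over p (mat_vec K A T)) A s) * sqrt (real K / real N)}"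
  assume *: "1 \<le> K \<and> K < p \<and> 1 \<le> N \<and>
       (\<forall>k<K. (\<lambda>j. A j k) \<in> prob_simplex p) \<and>
       1 \<le> s \<and> s \<le> K \<and> T \<in> sparse_simplex K s \<and>
       kappa K (J_under p N (mat_vec K A T)) A s > 0 \<and>
       kappa K (J_over p (mat_vec K A T)) A K > 0 \<and>
       real N \<ge> 6000 * max (M1 p K N A T s) (M2 p K A T s)"
  show "1 - 2 / real p - 4 / real K - 2 * exp (- real K) \<le> ?P"
  proof (cases "3 \<le> K")
    case True
    have "1 - 1 / real p - 2 / real K - 2 * exp (- real K) \<le> ?P"
    proof (rule prob_mle_error_ge)
      have "6000 * M1 p K N A T s \<le> 6000 * max (M1 p K N A T s) (M2 p K A T s)"
        "6000 * M2 p K A T s \<le> 6000 * max (M1 p K N A T s) (M2 p K A T s)"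
        by (intro mult_left_mono; simp)+
      then show "6000 * M1 p K N A T s \<le> real N" "6000 * M2 p K A T s \<le> real N"
        using * by linarith+
    qed (use * True in auto)
    moreover have "1 / real p \<le> 2 / real p" "2 / real K \<le> 4 / real K"
      by (intro divide_right_mono; simp)+
    ultimately show ?thesis by linarith
  next
    case False
    \<comment> \<open>The claimed lower bound for the probability is not positive here.\<close>
    then have "4 \<ge> real K" "0 < real K" using * by auto
    then have "1 \<le> 4 / real K" by simp
    then have "1 - 2 / real p - 4 / real K - 2 * exp (- real K) \<le> 0"
      using exp_ge_zero[of "- real K"] divide_nonneg_nonneg[of 2 "real p"] by linarith
    also have "0 \<le> ?P" by simp
    finally show ?thesis .
  qed
qed simp_all

end
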